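(* Let $X$ be a compact metric space with metric $d$, let $T\colon X\to X$ be a homeomorphism, let $\mu$ be a $T$-invariant Borel probability measure on $X$, and let $f\in L^1(X,\mu)$. Then the following statements are equivalent: (1) $f$ is $\mu$-mean equicontinuous. (2) $f$ is $\mu$-equicontinuous in the mean. (3) $\mu$ has bounded complexity with respect to $\{\bar f_n\}$. (4) $\mu$ has bounded complexity with respect to $\{\hat f_n\}$. (5) For any $\epsilon>0$ there are $k\in\mathbb{N}$ and measurable subsets $A_1,\dots,A_k$ of $X$ with $\mu\left(\bigcup_{i=1}^kA_i\right)>1-\epsilon$ such that $\hat f_n(x,y)<\epsilon$ for every $1\le i\le k$, all $x,y\in A_i$ and every $n\in\mathbb{N}$.
   Context: Here $f$ is regarded as an everywhere-defined measurable representative of its class; $\mathbb{N}=\{1,2,\dots\}$; $\#(F)$ is the number of elements of $F$. $f$ is $\mu$-mean equicontinuous if for any $\tau>0$ there is a compact subset $K\subset X$ with $\mu(K)>1-\tau$ such that for any $\epsilon>0$ there is $\delta>0$ such that whenever $x,y\in K$ with $d(x,y)<\delta$ we have $\limsup_{n\to\infty}\frac1n\sum_{i=0}^{n-1}|f(T^ix)-f(T^iy)|<\epsilon$. $f$ is $\mu$-equicontinuous in the mean if for any $\tau>0$ there is a compact subset $K\subset X$ with $\mu(K)>1-\tau$ such that for any $\epsilon>0$ there is $\delta>0$ such that whenever $x,y\in K$ with $d(x,y)<\delta$ we have $\frac1n\sum_{i=0}^{n-1}|f(T^ix)-f(T^iy)|<\epsilon$ for every $n\ge1$. For $x,y\in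 X$ and $n\ge1$ put $\bar f_n(x,y)=\frac1n\sum_{i=0}^{n-1}|f(T^ix)-f(T^iy)|$ and $\hat f_n(x,y)=\max\{\bar f_k(x,y):1\le k\le n\}$. For $\varepsilon>0$ let $B_{\bar f_n}(x,\varepsilon)=\{y\in X:\bar f_n(x,y)<\varepsilon\}$, $B_{\hat f_n}(x,\varepsilon)=\{y\in X:\hat f_n(x,y)<\varepsilon\}$, $K(n,\varepsilon,\bar f)=\min\{\#(F):F\subset X\text{ finite},\ \mu(\bigcup_{x\in F}B_{\bar f_n}(x,\varepsilon))>1-\varepsilon\}$, and $K(n,\varepsilon,\hat f)=\min\{\#(F):F\subset X\text{ finite},\ \mu(\bigcup_{x\in F}B_{\hat f_n}(x,\varepsilon))>1-\varepsilon\}$. $\mu$ has bounded complexity with respect to $\{\bar f_n\}$ (resp. $\{\hat f_n\}$) if for every $\varepsilon>0$ there exists a positive integer $C=C(\varepsilon)$ such that $K(n,\varepsilon,\bar f)\le C$ (resp. $K(n,\varepsilon,\hat f)\le C$) for all $n\ge1$. *)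

theory Defs
  imports "HOL-Probability.Probability"
begin

definition orbit_avg :: "('a \<Rightarrow> 'a) \<Rightarrow> ('a \<Rightarrow> complex) \<Rightarrow> nat \<Rightarrow> 'a \<Rightarrow> 'a \<Rightarrow> real" where
  "orbit_avg T f n x y = (\<Sum>i<n. cmod (f ((T ^^ i) x) - f ((T ^^ i) y))) / real n"

(* Only meaningful for n >= 1; every use below is restricted to such n. *)
definition orbit_avg_max :: "('a \<Rightarrow> 'a) \<Rightarrow> ('a \<Rightarrow> complex) \<Rightarrow> nat \<Rightarrow> 'a \<Rightarrow> 'a \<Rightarrow> real" where
  "orbit_avg_max T f n x y = Max ((\<lambda>k. orbit_avg T f k x y) ` {1..n})"

(* The limsup is taken in the extended reals: for unbounded f the averages may be unbounded,
   and limsup on real would then be a junk value. *)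
definition mean_equicontinuous ::
    "'a::metric_space measure \<Rightarrow> ('a \<Rightarrow> 'a) \<Rightarrow> ('a \<Rightarrow> complex) \<Rightarrow> bool" where
  "mean_equicontinuous \<mu> T f \<longleftrightarrow>
    (\<forall>\<tau>>0. \<exists>K. compact K \<and> measure \<mu> K > 1 - \<tau> \<and>
      (\<forall>\<epsilon>>0. \<exists>\<delta>>0. \<forall>x\<in>K. \<forall>y\<in>K. dist x y < \<delta> \<longrightarrow>
        limsup (\<lambda>n. ereal (orbit_avg T f n x y)) < ereal \<epsilon>))"

definition equicontinuous_in_the_mean ::
    "'a::metric_space measure \<Rightarrow> ('a \<Rightarrow> 'a) \<Rightarrow> ('a \<Rightarrow> complex) \<Rightarrow> bool" where
  "equicontinuous_in_the_mean \<mu> T f \<longleftrightarrow>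
    (\<forall>\<tau>>0. \<exists>K. compact K \<and> measure \<mu> K > 1 - \<tau> \<and>
      (\<forall>\<epsilon>>0. \<exists>\<delta>>0. \<forall>x\<in>K. \<forall>y\<in>K. dist x y < \<delta> \<longrightarrow>
        (\<forall>n\<ge>1. orbit_avg T f n x y < \<epsilon>)))"

(* The minimum is an infimum in enat, so it would be infinite (rather than 0) if there were
   no admissible finite F; an infimum over a nonempty set of enat is attained. *)
definition cover_number ::
    "'a measure \<Rightarrow> ('a \<Rightarrow> 'a \<Rightarrow> real) \<Rightarrow> real \<Rightarrow> enat" where
  "cover_number \<mu> \<rho> \<epsilon> =
    (INF F \<in> {F. finite F \<and> measure \<mu> (\<Union>x\<in>F. {y. \<rho> x y < \<epsilon>}) > 1 - \<epsilon>}. enat (card F))"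

definition bounded_complexity ::
    "'a measure \<Rightarrow> (nat \<Rightarrow> 'a \<Rightarrow> 'a \<Rightarrow> real) \<Rightarrow> bool" where
  "bounded_complexity \<mu> \<rho> \<longleftrightarrow>
    (\<forall>\<epsilon>>0. \<exists>C::nat. C \<ge> 1 \<and> (\<forall>n\<ge>1. cover_number \<mu> (\<rho> n) \<epsilon> \<le> enat C))"

end

theory Submission
  imports Defs "HOL-Real_Asymp.Real_Asymp"
begin

text \<open>
  Every condition is equivalent to the following one, which is (5): for each \<open>\<epsilon>\<close>, up to measure \<open>\<epsilon>\<close>
  the space is a finite union of measurable sets on which all averages are below \<open>\<epsilon>\<close>.
  Given a finite cover by sets of points whose averages to a fixed point are eventually small, Egorov
  makes the time uniform, and the finitely many earlier times are handled by splitting into the sets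
  where \<open>f, f \<circ> T, \<dots>, f \<circ> T\<^sup>N\<close> oscillate little; this gives (1) \<open>\<Longrightarrow>\<close> (5).  For (5) \<open>\<Longrightarrow>\<close> (2), shrink
  the pieces to disjoint compact sets and intersect over a sequence of \<open>\<epsilon>\<close>'s.
  For (3) \<open>\<Longrightarrow>\<close> (5), a cover by at most \<open>C\<close> balls at time \<open>n\<close> shows that most points are centres of
  balls of measure at least \<open>\<epsilon> / C\<close>, a bound independent of \<open>n\<close>.  Birkhoff's theorem for \<open>T \<times> T\<close>
  and the function \<open>\<bar>f x - f y\<bar>\<close> carries this over to the limit pseudometric, where a maximal disjoint
  family of such balls is finite and its enlargement is the required cover.
\<close>

section \<open>The pointwise ergodic theorem\<close>

text \<open>Applied with \<open>s\<close> the Birkhoff sums at a point, \<open>t\<close> those at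
  its image and \<open>d\<close> the value of the function at the point. Shifting \<open>n\<close>
  by one and subtracting a constant changes averages by o(1), which the gap between \<open>c\<close>
  and a rational \<open>c'\<close> still below \<open>a\<close> absorbs.\<close>

lemma frequently_shift:
  fixes s :: "nat \<Rightarrow> real"
  assumes t: "\<And>n. t n = s (Suc n) - d"
  shows "(\<exists>c\<in>\<rat>. c < a \<and> (\<exists>\<^sub>F n in sequentially. t n < c * real n)) \<longleftrightarrow>
    (\<exists>c\<in>\<rat>. c < a \<and> (\<exists>\<^sub>F n in sequentially. s n < c * real n))"
proof
  assume "\<exists>c\<in>\<rat>. c < a \<and> (\<exists>\<^sub>F n in sequentially. t n < c * real n)"
  then obtain c where c: "c < a" "\<exists>\<^sub>F n in sequentially. t n < c * real n" by blast
  obtain c' where c': "c' \<in> \<rat>" "c < c'" "c' < a" using Rats_dense_in_real[OF c(1)] by blast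
  have "\<forall>\<^sub>F n in sequentially. d + c * real n < c' * real (Suc n)"
    using c'(2) by real_asymp
  then have "\<exists>\<^sub>F n in sequentially. s (Suc n) < c' * real (Suc n)"
    by (intro frequently_rev_mp[OF c(2)]) (elim eventually_mono, auto simp: t)
  then have "\<exists>\<^sub>F n in sequentially. s n < c' * real n"
    unfolding frequently_sequentially by (meson Suc_leD le_SucI)
  then show "\<exists>c\<in>\<rat>. c < a \<and> (\<exists>\<^sub>F n in sequentially. s n < c * real n)" using c' by blast
next
  assume "\<exists>c\<in>\<rat>. c < a \<and> (\<exists>\<^sub>F n in sequentially. s n < c * real n)"
  then obtain c where c: "c < a" "\<exists>\<^sub>F n in sequentially. s n < c * real n" by blast
  obtain c' where c': "c' \<in> \<rat>" "c < c'" "c' < a" using Rats_dense_in_real[OF c(1)] by blast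
  have "\<exists>\<^sub>F n in sequentially. s (Suc n) < c * real (Suc n)"
    using c(2) unfolding frequently_sequentially by (metis Suc_le_D Suc_le_mono)
  moreover have "\<forall>\<^sub>F n in sequentially. c * real (Suc n) - d < c' * real n"
    using c'(2) by real_asymp
  ultimately have "\<exists>\<^sub>F n in sequentially. t n < c' * real n"
    by (elim frequently_rev_mp) (elim eventually_mono, auto simp: t)
  then show "\<exists>c\<in>\<rat>. c < a \<and> (\<exists>\<^sub>F n in sequentially. t n < c * real n)" using c' by blast
qed

locale measure_preserving = prob_space M for M :: "'a measure" +
  fixes T :: "'a \<Rightarrow> 'a"
  assumes T_measurable [measurable]: "T \<in> measurable M M"
    and distr_T: "distr M M T = M"
begin

lemma T_in_space: "x \<in> space M \<Longrightarrow> T x \<in> space M"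
  using T_measurable by (rule measurable_space)

lemma funpow_measurable [measurable]: "T ^^ n \<in> measurable M M"
  by (rule measurable_compose_n) measurable

lemma integrable_comp_T:
  fixes h :: "'a \<Rightarrow> real"
  assumes "integrable M h"
  shows "integrable M (\<lambda>x. h (T x))"
  using integrable_distr[OF T_measurable, of h] assms distr_T by simp

lemma integral_comp_T:
  fixes h :: "'a \<Rightarrow> real"
  assumes "h \<in> borel_measurable M"
  shows "(\<integral>x. h (T x) \<partial>M) = (\<integral>x. h x \<partial>M)"
  using integral_distr[OF T_measurable assms] distr_T by simp

definition birkhoff_sum :: "('a \<Rightarrow> real) \<Rightarrow> nat \<Rightarrow> 'a \<Rightarrow> real" where
  "birkhoff_sum h n x = (\<Sum>i<n. h ((T ^^ i) x))"

lemma birkhoff_sum_measurable [measurable]: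
  assumes [measurable]: "h \<in> borel_measurable M"
  shows "birkhoff_sum h n \<in> borel_measurable M"
  unfolding birkhoff_sum_def by measurable

lemma birkhoff_sum_Suc: "birkhoff_sum h (Suc n) x = h x + birkhoff_sum h n (T x)"
  unfolding birkhoff_sum_def sum.lessThan_Suc_shift
  by (simp add: funpow_Suc_right del: funpow.simps)

lemma birkhoff_sum_uminus: "birkhoff_sum (\<lambda>x. - h x) n x = - birkhoff_sum h n x"
  by (simp add: birkhoff_sum_def sum_negf)

section \<open>Maximal ergodic inequality\<close>

text \<open>This is the maximum of the Birkhoff sums of lengths 0 to \<open>n\<close>. The recursive
  form makes the key identity of Garsia's argument a defining equation.\<close>

fun max_sum :: "('a \<Rightarrow> real) \<Rightarrow> nat \<Rightarrow> 'a \<Rightarrow> real" where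
  "max_sum h 0 x = 0"
| "max_sum h (Suc n) x = max 0 (h x + max_sum h n (T x))"

lemma max_sum_measurable [measurable]:
  assumes [measurable]: "h \<in> borel_measurable M"
  shows "max_sum h n \<in> borel_measurable M"
proof (induction n)
  case 0
  have "max_sum h 0 = (\<lambda>x. 0)" by auto
  then show ?case by simp
next
  case (Suc n)
  note [measurable] = Suc
  have "max_sum h (Suc n) = (\<lambda>x. max 0 (h x + max_sum h n (T x)))" by auto
  then show ?case by simp
qed

lemma max_sum_integrable:
  assumes "integrable M h"
  shows "integrable M (max_sum h n)"
proof (induction n)
  case 0
  have "max_sum h 0 = (\<lambda>x. 0)" by auto
  then show ?case by simp
next
  case (Suc n)
  have "max_sum h (Suc n) = (\<lambda>x. max 0 (h x + max_sum h n (T x)))" by auto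
  then show ?case using assms integrable_comp_T[OF Suc] by simp
qed

lemma max_sum_nonneg: "0 \<le> max_sum h n x"
  by (cases n) auto

lemma max_sum_mono: "m \<le> n \<Longrightarrow> max_sum h m x \<le> max_sum h n x"
proof (induction m arbitrary: n x)
  case 0
  then show ?case by (simp add: max_sum_nonneg)
next
  case (Suc m)
  then obtain n' where "n = Suc n'" "m \<le> n'" by (cases n) auto
  then show ?case using Suc.IH[of n' "T x"] by (auto simp: max_def)
qed

text \<open>Each value of \<open>max_sum\<close> is itself a Birkhoff sum, and each Birkhoff sum is
  at most the \<open>max_sum\<close> of the same index.\<close>

lemma max_sum_pos_iff: "(\<exists>n. 0 < max_sum h n x) \<longleftrightarrow> (\<exists>n. 0 < birkhoff_sum h n x)"
proof
  have "\<exists>k. max_sum h n x = birkhoff_sum h k x" for n x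
  proof (induction n arbitrary: x)
    case 0
    show ?case by (rule exI[of _ 0]) (simp add: birkhoff_sum_def)
  next
    case (Suc n)
    obtain k where "max_sum h n (T x) = birkhoff_sum h k (T x)" using Suc by blast
    then have "max_sum h (Suc n) x = birkhoff_sum h 0 x \<or>
        max_sum h (Suc n) x = birkhoff_sum h (Suc k) x"
      by (auto simp: birkhoff_sum_Suc max_def birkhoff_sum_def[of h 0])
    then show ?case by blast
  qed
  then show "\<exists>n. 0 < max_sum h n x \<Longrightarrow> \<exists>n. 0 < birkhoff_sum h n x" by metis
next
  have "birkhoff_sum h n x \<le> max_sum h n x" for n x
  proof (induction n arbitrary: x)
    case 0
    show ?case by (simp add: birkhoff_sum_def)
  next
    case (Suc n)
    show ?case using Suc[of "T x"] by (simp add: birkhoff_sum_Suc)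
  qed
  then show "\<exists>n. 0 < birkhoff_sum h n x \<Longrightarrow> \<exists>n. 0 < max_sum h n x"
    by (meson less_le_trans)
qed

text \<open>Garsia's argument: \<open>max_sum h n - max_sum h n \<circ> T\<close> has integral zero and is dominated by
  \<open>h\<close> on the set where \<open>max_sum h n\<close> is positive, and by \<open>0\<close> elsewhere.\<close>

lemma maximal_ergodic:
  assumes h: "integrable M h"
  shows "0 \<le> (\<integral>x. indicator {x \<in> space M. \<exists>n. 0 < birkhoff_sum h n x} x * h x \<partial>M)"
proof -
  note [measurable] = borel_measurable_integrable[OF h]
  define E where "E n = {x \<in> space M. 0 < max_sum h n x}" for n
  have E_meas [measurable]: "E n \<in> sets M" for n
    unfolding E_def by measurable
  have nonneg: "0 \<le> (\<integral>x. indicator (E n) x * h x \<partial>M)" for n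
  proof -
    have "0 = (\<integral>x. max_sum h n x - max_sum h n (T x) \<partial>M)"
      using max_sum_integrable[OF h] integrable_comp_T[OF max_sum_integrable[OF h]]
      by (simp add: integral_comp_T)
    also have "\<dots> \<le> (\<integral>x. indicator (E n) x * h x \<partial>M)"
    proof (rule integral_mono)
      show "integrable M (\<lambda>x. max_sum h n x - max_sum h n (T x))"
        using max_sum_integrable[OF h] integrable_comp_T[OF max_sum_integrable[OF h]] by simp
      show "integrable M (\<lambda>x. indicator (E n) x * h x)"
        using integrable_mult_indicator[OF E_meas h] by simp
      fix x assume x: "x \<in> space M"
      show "max_sum h n x - max_sum h n (T x) \<le> indicator (E n) x * h x"
      proof (cases "0 < max_sum h n x")
        case True
        then obtain m where m: "n = Suc m" by (cases n) auto
        \<comment> \<open>Where the maximum is positive, the recursion reads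
          \<open>max_sum h n x = h x + max_sum h m (T x)\<close>; monotonicity replaces
          \<open>m\<close> by \<open>n\<close>.\<close>
        have "max_sum h m (T x) \<le> max_sum h n (T x)" using m by (intro max_sum_mono) simp
        then show ?thesis using True x m by (auto simp: E_def indicator_def)
      next
        case False
        then show ?thesis using max_sum_nonneg[of h n "T x"] by (auto simp: E_def indicator_def)
      qed
    qed
    finally show ?thesis .
  qed
  have *: "{x \<in> space M. \<exists>n. 0 < birkhoff_sum h n x} = (\<Union>n. E n)"
    unfolding E_def max_sum_pos_iff[symmetric] by blast
  have "incseq E"
    unfolding E_def incseq_def by (auto intro: less_le_trans[OF _ max_sum_mono])
  have "(\<lambda>n. \<integral>x. indicator (E n) x * h x \<partial>M) \<longlonglongrightarrow> (\<integral>x. indicator (\<Union>n. E n) x * h x \<partial>M)"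
  proof (rule integral_dominated_convergence[where w = "\<lambda>x. \<bar>h x\<bar>"])
    show "AE x in M. (\<lambda>n. indicator (E n) x * h x) \<longlonglongrightarrow> indicator (\<Union>n. E n) x * h x"
      by (intro AE_I2 tendsto_mult tendsto_const LIMSEQ_indicator_incseq \<open>incseq E\<close>)
    show "integrable M (\<lambda>x. \<bar>h x\<bar>)" using h by simp
    show "AE x in M. norm (indicator (E n) x * h x) \<le> \<bar>h x\<bar>" for n
      by (intro AE_I2) (simp add: abs_mult mult_left_le_one_le)
  qed measurable
  then show ?thesis
    unfolding * by (rule LIMSEQ_le_const) (use nonneg in blast)
qed

text \<open>The maximal inequality is applied to \<open>h\<close> cut off outside \<open>E\<close>.
  Invariance makes the cut-off pass through Birkhoff sums, so the set where some sum is positive is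
  exactly \<open>E\<close>.\<close>

lemma maximal_ergodic_invariant:
  assumes h: "integrable M h" and E [measurable]: "E \<in> sets M"
    and inv: "\<And>x. x \<in> space M \<Longrightarrow> T x \<in> E \<longleftrightarrow> x \<in> E"
    and pos: "\<And>x. x \<in> E \<Longrightarrow> \<exists>n. 0 < birkhoff_sum h n x"
  shows "0 \<le> (\<integral>x. indicator E x * h x \<partial>M)"
proof -
  let ?h = "\<lambda>x. indicator E x * h x"
  have "birkhoff_sum ?h n x = indicator E x * birkhoff_sum h n x" if "x \<in> space M" for n x
    using that
  proof (induction n arbitrary: x)
    case 0
    show ?case by (simp add: birkhoff_sum_def)
  next
    case (Suc n)
    have "indicator E (T x) = (indicator E x :: real)"
      using inv[OF Suc.prems] by (simp add: indicator_def)
    then show ?case using Suc.IH[OF T_in_space[OF Suc.prems]]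
      by (simp add: birkhoff_sum_Suc algebra_simps)
  qed
  then have "{x \<in> space M. \<exists>n. 0 < birkhoff_sum ?h n x} = E"
    using pos sets.sets_into_space[OF E]
    by (auto simp: indicator_def zero_less_mult_iff of_bool_def split: if_splits)
  moreover have "integrable M ?h"
    using integrable_mult_indicator[OF E h] by simp
  ultimately have "0 \<le> (\<integral>x. indicator E x * (indicator E x * h x) \<partial>M)"
    using maximal_ergodic[of ?h] by simp
  also have "\<dots> = (\<integral>x. indicator E x * h x \<partial>M)"
    by (intro Bochner_Integration.integral_cong) (auto simp: indicator_def)
  finally show ?thesis .
qed

text \<open>Leaving room for a \<open>c < a\<close> makes this set exactly invariant; taking \<open>c\<close> rational makes it
  measurable.\<close>

definition low_avg_set :: "('a \<Rightarrow> real) \<Rightarrow> real \<Rightarrow> 'a set" where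
  "low_avg_set h a = {x \<in> space M. \<exists>c\<in>\<rat>. c < a \<and> (\<exists>\<^sub>F n in sequentially. birkhoff_sum h n x < c * real n)}"

lemma low_avg_set_measurable [measurable]:
  assumes [measurable]: "h \<in> borel_measurable M"
  shows "low_avg_set h a \<in> sets M"
proof -
  have "low_avg_set h a = (\<Union>c\<in>{c\<in>\<rat>. c < a}. {x \<in> space M. \<forall>m. \<exists>n\<ge>m. birkhoff_sum h n x < c * real n})"
    by (auto simp: low_avg_set_def frequently_sequentially)
  moreover have "countable {c\<in>\<rat>. c < a}"
    by (rule countable_subset[OF _ countable_rat]) auto
  ultimately show ?thesis by (auto intro!: sets.countable_UN'')
qed

lemma low_avg_set_invariant:
  assumes "x \<in> space M"
  shows "T x \<in> low_avg_set h a \<longleftrightarrow> x \<in> low_avg_set h a"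
  using frequently_shift[of "\<lambda>n. birkhoff_sum h n (T x)" "\<lambda>n. birkhoff_sum h n x" "h x" a]
    assms T_in_space[OF assms]
  by (auto simp: low_avg_set_def birkhoff_sum_Suc)

text \<open>On \<open>E\<close> some average of \<open>h\<close> drops below \<open>a\<close>, so
  some Birkhoff sum of \<open>a - h\<close> is positive and the maximal inequality applies to it.
  Invariant subsets are allowed because the lemma is used on intersections of two such sets.\<close>

lemma low_avg_set_integral_le:
  assumes h: "integrable M h" and E [measurable]: "E \<in> sets M"
    and inv: "\<And>x. x \<in> space M \<Longrightarrow> T x \<in> E \<longleftrightarrow> x \<in> E"
    and sub: "E \<subseteq> low_avg_set h a"
  shows "(\<integral>x. indicator E x * h x \<partial>M) \<le> a * measure M E"
proof -
  have "0 \<le> (\<integral>x. indicator E x * (a - h x) \<partial>M)"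
  proof (rule maximal_ergodic_invariant[OF _ E inv])
    show "integrable M (\<lambda>x. a - h x)" using h by simp
    fix x assume "x \<in> E"
    then obtain c where c: "c < a" "\<exists>\<^sub>F n in sequentially. birkhoff_sum h n x < c * real n"
      using sub by (auto simp: low_avg_set_def)
    then obtain n where "birkhoff_sum h n x < c * real n"
      by (auto dest: frequently_ex)
    moreover have "c * real n \<le> a * real n" using c by (simp add: mult_right_mono)
    moreover have "birkhoff_sum (\<lambda>x. a - h x) n x = a * real n - birkhoff_sum h n x"
      by (simp add: birkhoff_sum_def sum_subtractf)
    ultimately have "0 < birkhoff_sum (\<lambda>x. a - h x) n x" by simp
    then show "\<exists>n. 0 < birkhoff_sum (\<lambda>x. a - h x) n x" by blast
  qed auto
  also have "\<dots> = (\<integral>x. indicator E x * a - indicator E x * h x \<partial>M)"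
    by (simp add: algebra_simps)
  also have "\<dots> = (\<integral>x. indicator E x * a \<partial>M) - (\<integral>x. indicator E x * h x \<partial>M)"
    using integrable_mult_indicator[OF E h]
    by (intro Bochner_Integration.integral_diff) (auto simp: integrable_indicator_iff less_top[symmetric])
  finally show ?thesis using sets.sets_into_space[OF E] by (simp add: Int_absorb2 mult.commute)
qed

text \<open>This is almost everywhere convergence in the extended reals, phrased without naming the
  limit. Oscillation across rational levels \<open>a < b\<close> puts a point in
  \<open>E a b\<close>, over which the integral of \<open>h\<close> is at most \<open>a\<close> and
  at least \<open>b\<close> times the measure; hence \<open>E a b\<close> is null, and countably
  many pairs suffice.\<close>

lemma birkhoff_convergence:
  assumes h: "integrable M h"
  shows "AE x in M. \<forall>a b. a < b \<longrightarrow>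
    (\<exists>\<^sub>F n in sequentially. birkhoff_sum h n x / real n < a) \<longrightarrow>
    (\<forall>\<^sub>F n in sequentially. birkhoff_sum h n x / real n < b)"
proof -
  note [measurable] = borel_measurable_integrable[OF h]
  define E where "E a b = low_avg_set h a \<inter> low_avg_set (\<lambda>x. - h x) (- b)" for a b
  have null: "measure M (E a b) = 0" if "a < b" for a b
  proof -
    have E: "E a b \<in> sets M" unfolding E_def by measurable
    have inv: "T x \<in> E a b \<longleftrightarrow> x \<in> E a b" if "x \<in> space M" for x
      using low_avg_set_invariant[OF that] by (simp add: E_def)
    have "(\<integral>x. indicator (E a b) x * h x \<partial>M) \<le> a * measure M (E a b)"
      by (rule low_avg_set_integral_le[OF h E inv]) (auto simp: E_def)
    moreover have "(\<integral>x. indicator (E a b) x * (- h x) \<partial>M) \<le> - b * measure M (E a b)"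
      by (rule low_avg_set_integral_le[OF _ E inv]) (use h in \<open>auto simp: E_def\<close>)
    ultimately have "(b - a) * measure M (E a b) \<le> 0" by (simp add: algebra_simps)
    then show ?thesis using that measure_nonneg[of M "E a b"] by (simp add: mult_le_0_iff)
  qed
  have "AE x in M. \<forall>a\<in>\<rat>. \<forall>b\<in>\<rat>. a < b \<longrightarrow> x \<notin> E a b"
  proof (subst AE_ball_countable[OF countable_rat], rule ballI,
      subst AE_ball_countable[OF countable_rat], rule ballI)
    fix a b :: real
    have [measurable]: "E a b \<in> sets M" unfolding E_def by measurable
    show "AE x in M. a < b \<longrightarrow> x \<notin> E a b"
    proof (cases "a < b")
      case True
      then have "E a b \<in> null_sets M" using null by (simp add: null_setsI emeasure_eq_measure)
      then show ?thesis using AE_not_in by fastforce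
    qed simp
  qed
  then show ?thesis
  proof (rule AE_mp, intro AE_I2 impI allI)
    fix x and a b :: real
    assume x: "x \<in> space M" "\<forall>a\<in>\<rat>. \<forall>b\<in>\<rat>. a < b \<longrightarrow> x \<notin> E a b" and "a < b"
      and freq: "\<exists>\<^sub>F n in sequentially. birkhoff_sum h n x / real n < a"
    \<comment> \<open>The outer rationals \<open>a1\<close> and \<open>b2\<close> serve as slopes
      and the inner ones \<open>a2\<close> and \<open>b1\<close> as levels, since
      \<open>low_avg_set\<close> asks for a slope strictly below its level.\<close>
    obtain a1 where a1: "a1 \<in> \<rat>" "a < a1" "a1 < b" using Rats_dense_in_real[OF \<open>a < b\<close>] by blast
    obtain a2 where a2: "a2 \<in> \<rat>" "a1 < a2" "a2 < b" using Rats_dense_in_real[OF a1(3)] by blast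
    obtain b1 where b1: "b1 \<in> \<rat>" "a2 < b1" "b1 < b" using Rats_dense_in_real[OF a2(3)] by blast
    obtain b2 where b2: "b2 \<in> \<rat>" "b1 < b2" "b2 < b" using Rats_dense_in_real[OF b1(3)] by blast
    have pos: "\<forall>\<^sub>F n in sequentially. 0 < n" by (rule eventually_gt_at_top)
    have "\<exists>\<^sub>F n in sequentially. birkhoff_sum h n x < a1 * real n"
      using freq
    proof (rule frequently_rev_mp, intro eventually_mono[OF pos] impI)
      fix n assume "0 < n" "birkhoff_sum h n x / real n < a"
      then have "birkhoff_sum h n x / real n < a1" using a1 by simp
      then show "birkhoff_sum h n x < a1 * real n" using \<open>0 < n\<close> by (simp add: field_simps)
    qed
    then have "x \<in> low_avg_set h a2" using x(1) a1 a2 by (auto simp: low_avg_set_def)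
    moreover have "x \<notin> E a2 b1" using x(2) a2 b1 by blast
    ultimately have "x \<notin> low_avg_set (\<lambda>x. - h x) (- b1)" by (simp add: E_def)
    then have "\<not> (\<exists>\<^sub>F n in sequentially. - birkhoff_sum h n x < - b2 * real n)"
      using x(1) b2 by (auto simp: low_avg_set_def birkhoff_sum_uminus dest!: bspec[of _ _ "- b2"])
    then have "\<forall>\<^sub>F n in sequentially. birkhoff_sum h n x \<le> b2 * real n"
      by (simp add: not_frequently not_less)
    then show "\<forall>\<^sub>F n in sequentially. birkhoff_sum h n x / real n < b"
    proof (rule eventually_elim2[OF pos])
      fix n assume "0 < n" "birkhoff_sum h n x \<le> b2 * real n"
      then have "birkhoff_sum h n x / real n \<le> b2" by (simp add: field_simps)
      then show "birkhoff_sum h n x / real n < b" using b2 by simp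
    qed
  qed
qed

end

section \<open>Almost partitions\<close>

lemma (in finite_measure) Lim_measure_incseq_less:
  assumes "range A \<subseteq> sets M" "incseq A" "c < measure M (\<Union>i. A i)"
  shows "\<exists>n::nat. c < measure M (A n)"
  using order_tendstoD(1)[OF finite_Lim_measure_incseq[OF assms(1,2)] assms(3)]
  by (auto simp: eventually_sequentially)

section \<open>Regularity of finite Borel measures on metric spaces\<close>

lemma closed_approx_of_open:
  fixes U :: "'a::metric_space set"
  assumes "open U"
  obtains C :: "nat \<Rightarrow> 'a set" where "\<And>n. closed (C n)" "incseq C" "(\<Union>n. C n) = U"
proof (cases "U = UNIV")
  \<comment> \<open>Here \<open>- U\<close> is empty and \<open>infdist\<close> to the empty set is
    0 by convention, so the sets of the other case would all be empty.\<close>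
  case True
  then show ?thesis using that[of "\<lambda>_. UNIV"] by (auto simp: incseq_def)
next
  case False
  define C where "C n = {x. inverse (real (Suc n)) \<le> infdist x (- U)}" for n
  have "closed (C n)" for n
    unfolding C_def by (intro closed_Collect_le continuous_intros)
  moreover have "incseq C"
    unfolding incseq_def
  proof (intro allI impI)
    fix m n :: nat assume "m \<le> n"
    then have "inverse (real (Suc n)) \<le> inverse (real (Suc m))"
      by (intro le_imp_inverse_le) auto
    then show "C m \<subseteq> C n" unfolding C_def using order_trans by blast
  qed
  moreover have "(\<Union>n. C n) = U"
  proof (intro equalityI subsetI)
    fix x assume "x \<in> (\<Union>n. C n)"
    then obtain n where "inverse (real (Suc n)) \<le> infdist x (- U)" by (auto simp: C_def)
    moreover have "0 < inverse (real (Suc n))" by simp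
    ultimately have "infdist x (- U) \<noteq> 0" by linarith
    then show "x \<in> U" using infdist_zero[of x "- U"] by blast
  next
    fix x assume "x \<in> U"
    then have "0 < infdist x (- U)"
      using in_closed_iff_infdist_zero[of "- U" x] assms False infdist_nonneg[of x "- U"]
      by (auto simp: less_le)
    then obtain n where "inverse (real (Suc n)) < infdist x (- U)"
      using reals_Archimedean by blast
    then show "x \<in> (\<Union>n. C n)" by (auto simp: C_def intro: less_imp_le)
  qed
  ultimately show ?thesis using that by blast
qed

text \<open>The library's \<open>inner_regular\<close> asks for a Polish space type; approximation by closed sets needs
  neither completeness nor second countability.\<close>

lemma closed_inner_open_outer:
  fixes M :: "'a::metric_space measure"
  assumes "finite_measure M"
    and sets_M: "sets M = sets borel" and "B \<in> sets M" "0 < e"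
  shows "\<exists>C U. closed C \<and> open U \<and> C \<subseteq> B \<and> B \<subseteq> U \<and> measure M (U - C) < e"
proof -
  interpret finite_measure M by fact
  have closed_sets: "closed C \<Longrightarrow> C \<in> sets M" and open_sets: "open C \<Longrightarrow> C \<in> sets M" for C
    by (simp_all add: sets_M)
  have "B \<in> sigma_sets UNIV {S. open S}"
    using \<open>B \<in> sets M\<close> by (simp add: sets_M borel_def)
  then show ?thesis using \<open>0 < e\<close>
  proof (induction arbitrary: e)
    case (Basic U)
    then have U: "open U" by simp
    obtain C where C: "\<And>n. closed (C n)" "incseq C" "(\<Union>n. C n) = U"
      using closed_approx_of_open[OF U] by blast
    have "\<exists>n. measure M U - e < measure M (C n)"
      by (rule Lim_measure_incseq_less) (use C Basic.prems closed_sets in auto)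
    then obtain n where n: "measure M U - e < measure M (C n)" by blast
    have "C n \<subseteq> U" using C(3) by blast
    then have "measure M (U - C n) = measure M U - measure M (C n)"
      using closed_sets[OF C(1)] open_sets[OF U] by (intro finite_measure_Diff) auto
    then show ?case using n C(1) U \<open>C n \<subseteq> U\<close>
      by (intro exI[of _ "C n"] exI[of _ U]) auto
  next
    case Empty
    then show ?case by (intro exI[of _ "{}"]) auto
  next
    \<comment> \<open>Approximating from inside and outside at once is what lets the induction pass
      to complements: the two sets swap roles.\<close>
    case (Compl B)
    obtain C U where "closed C" "open U" "C \<subseteq> B" "B \<subseteq> U" "measure M (U - C) < e"
      using Compl.IH[OF Compl.prems] by blast
    moreover have "(- C) - (- U) = U - C" by blast
    ultimately show ?case
      by (intro exI[of _ "- U"] exI[of _ "- C"]) (auto simp: open_Compl closed_Compl)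
  next
    case (Union B)
    have "\<exists>C U. closed C \<and> open U \<and> C \<subseteq> B i \<and> B i \<subseteq> U \<and> measure M (U - C) < e / 2 * (1/2) ^ Suc i" for i
      using Union.IH[of "e / 2 * (1/2) ^ Suc i" i] Union.prems by simp
    then obtain C U where CU: "\<And>i. closed (C i)" "\<And>i. open (U i)" "\<And>i. C i \<subseteq> B i" "\<And>i. B i \<subseteq> U i"
      "\<And>i. measure M (U i - C i) < e / 2 * (1/2) ^ Suc i" by metis
    note [measurable] = closed_sets[OF CU(1)] open_sets[OF CU(2)]
    \<comment> \<open>A countable union of closed sets need not be closed, so it is truncated. Half
      of \<open>e\<close> pays for the truncation, the other half for the geometric sum of the
      errors of the single sets.\<close>
    define D where "D n = (\<Union>i\<le>n. C i)" for n
    have D_closed: "closed (D n)" for n unfolding D_def by (intro closed_UN) (auto simp: CU)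
    have D_Un: "(\<Union>n. D n) = (\<Union>i. C i)" by (auto simp: D_def)
    have "\<exists>n. measure M (\<Union>i. C i) - e / 2 < measure M (D n)"
      unfolding D_Un[symmetric]
      by (rule Lim_measure_incseq_less)
        (use Union.prems closed_sets[OF D_closed] in \<open>auto simp: incseq_def D_def intro: order_trans\<close>)
    then obtain n where n: "measure M (\<Union>i. C i) - e / 2 < measure M (D n)" by blast
    have [measurable]: "D n \<in> sets M" by (rule closed_sets[OF D_closed])
    have "measure M ((\<Union>i. C i) - D n) = measure M (\<Union>i. C i) - measure M (D n)"
      by (intro finite_measure_Diff) (auto simp: D_def)
    then have 1: "measure M ((\<Union>i. C i) - D n) < e / 2" using n by simp
    have geo: "(\<lambda>i. e / 2 * (1/2) ^ Suc i) sums (e / 2 * 1)"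
      using power_half_series by (rule sums_mult)
    have summ: "summable (\<lambda>i. measure M (U i - C i))"
      by (rule summable_comparison_test[OF _ sums_summable[OF geo]])
        (use less_imp_le[OF CU(5)] in simp)
    have "measure M (\<Union>i. U i - C i) \<le> (\<Sum>i. measure M (U i - C i))"
      by (rule finite_measure_subadditive_countably) (use summ in auto)
    also have "\<dots> \<le> e / 2"
      using suminf_le[OF less_imp_le[OF CU(5)] summ sums_summable[OF geo]] sums_unique[OF geo] by simp
    finally have 2: "measure M (\<Union>i. U i - C i) \<le> e / 2" .
    have "measure M ((\<Union>i. U i) - D n) \<le> measure M ((\<Union>i. U i - C i) \<union> ((\<Union>i. C i) - D n))"
      by (rule finite_measure_mono) auto
    also have "\<dots> \<le> measure M (\<Union>i. U i - C i) + measure M ((\<Union>i. C i) - D n)"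
      by (rule measure_Un_le) auto
    finally have "measure M ((\<Union>i. U i) - D n) < e" using 1 2 by simp
    moreover have "D n \<subseteq> (\<Union>i. B i)" "(\<Union>i. B i) \<subseteq> (\<Union>i. U i)"
      using CU(3,4) by (fastforce simp: D_def)+
    ultimately show ?case using D_closed CU(2)
      by (intro exI[of _ "D n"] exI[of _ "\<Union>i. U i"]) auto
  qed
qed

lemma closed_inner_regular:
  fixes M :: "'a::metric_space measure"
  assumes "finite_measure M"
    and sets_M: "sets M = sets borel" and B: "B \<in> sets M" and "0 < e"
  shows "\<exists>C. closed C \<and> C \<subseteq> B \<and> measure M B - e < measure M C"
proof -
  interpret finite_measure M by fact
  obtain C U where CU: "closed C" "open U" "C \<subseteq> B" "B \<subseteq> U" "measure M (U - C) < e"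
    using closed_inner_open_outer[OF assms] by blast
  have C: "C \<in> sets M" using CU(1) by (simp add: sets_M)
  have "measure M B - measure M C = measure M (B - C)"
    using finite_measure_Diff[OF B C CU(3)] by simp
  also have "\<dots> \<le> measure M (U - C)"
    by (rule finite_measure_mono) (use CU in \<open>auto simp: sets_M\<close>)
  finally show ?thesis using CU by (intro exI[of _ C]) auto
qed

section \<open>Finite covers up to small measure\<close>

text \<open>The pieces may overlap. The error \<open>e\<close> is kept apart from the relation so
  that relations can be conjoined while their errors add.\<close>

definition almost_partition :: "'a measure \<Rightarrow> real \<Rightarrow> ('a \<Rightarrow> 'a \<Rightarrow> bool) \<Rightarrow> bool" where
  "almost_partition M e P \<longleftrightarrow>
    (\<exists>\<A>. finite \<A> \<and> \<A> \<subseteq> sets M \<and> 1 - e < measure M (\<Union>\<A>) \<and> (\<forall>A\<in>\<A>. \<forall>x\<in>A. \<forall>y\<in>A. P x y))"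

lemma almost_partition_mono:
  assumes "almost_partition M e P" "e \<le> e'" "\<And>x y. P x y \<Longrightarrow> Q x y"
  shows "almost_partition M e' Q"
proof -
  obtain \<A> where \<A>: "finite \<A>" "\<A> \<subseteq> sets M" "1 - e < measure M (\<Union>\<A>)"
    "\<And>A x y. A \<in> \<A> \<Longrightarrow> x \<in> A \<Longrightarrow> y \<in> A \<Longrightarrow> P x y"
    using assms(1) unfolding almost_partition_def by blast
  then show ?thesis
    unfolding almost_partition_def using assms(2,3) by (intro exI[of _ \<A>]) auto
qed

text \<open>Intersecting the pieces pairwise gives a common refinement, whose union is the
  intersection of the two unions.\<close>

lemma (in prob_space) almost_partition_conj:
  assumes "almost_partition M e P" "almost_partition M e' Q"
  shows "almost_partition M (e + e') (\<lambda>x y. P x y \<and> Q x y)"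
proof -
  obtain \<A> where \<A>: "finite \<A>" "\<A> \<subseteq> sets M" "1 - e < measure M (\<Union>\<A>)"
    "\<And>A x y. A \<in> \<A> \<Longrightarrow> x \<in> A \<Longrightarrow> y \<in> A \<Longrightarrow> P x y"
    using assms(1) unfolding almost_partition_def by blast
  obtain \<B> where \<B>: "finite \<B>" "\<B> \<subseteq> sets M" "1 - e' < measure M (\<Union>\<B>)"
    "\<And>A x y. A \<in> \<B> \<Longrightarrow> x \<in> A \<Longrightarrow> y \<in> A \<Longrightarrow> Q x y"
    using assms(2) unfolding almost_partition_def by blast
  define \<C> where "\<C> = (\<lambda>(A, B). A \<inter> B) ` (\<A> \<times> \<B>)"
  have A: "\<Union>\<A> \<in> sets M" and B: "\<Union>\<B> \<in> sets M"
    using \<A> \<B> by (auto intro!: sets.finite_Union)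
  have "\<Union>\<C> = \<Union>\<A> \<inter> \<Union>\<B>" by (auto simp: \<C>_def)
  moreover have "measure M (\<Union>\<A> \<union> \<Union>\<B>) = measure M (\<Union>\<A>) + measure M (\<Union>\<B>) - measure M (\<Union>\<A> \<inter> \<Union>\<B>)"
    using A B by (intro measure_Un3) (auto simp: fmeasurable_eq_sets)
  moreover have "measure M (\<Union>\<A> \<union> \<Union>\<B>) \<le> 1" by (rule prob_le_1)
  ultimately have "1 - (e + e') < measure M (\<Union>\<C>)" using \<A>(3) \<B>(3) by simp
  moreover have "\<C> \<subseteq> sets M" using \<A>(2) \<B>(2) by (auto simp: \<C>_def)
  moreover have "finite \<C>" using \<A>(1) \<B>(1) by (simp add: \<C>_def)
  moreover have "\<forall>A\<in>\<C>. \<forall>x\<in>A. \<forall>y\<in>A. P x y \<and> Q x y"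
    using \<A>(4) \<B>(4) by (auto simp: \<C>_def)
  ultimately show ?thesis unfolding almost_partition_def by blast
qed

text \<open>Preimages of the balls of radius \<open>r / 2\<close> about a countable dense set cover
  the space; by continuity from below, finitely many of them suffice up to measure
  \<open>e\<close>.\<close>

lemma (in prob_space) almost_partition_measurable:
  fixes g :: "'a \<Rightarrow> 'b::{metric_space, second_countable_topology}"
  assumes [measurable]: "g \<in> borel_measurable M" and "0 < e" "0 < r"
  shows "almost_partition M e (\<lambda>x y. dist (g x) (g y) < r)"
proof -
  obtain D :: "'b set" where D: "countable D" "\<And>X. open X \<Longrightarrow> X \<noteq> {} \<Longrightarrow> \<exists>d\<in>D. d \<in> X"
    using countable_dense_setE by blast
  define A where "A i = {x \<in> space M. dist (from_nat_into D i) (g x) < r / 2}" for i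
  have A_sets [measurable]: "A i \<in> sets M" for i unfolding A_def by measurable
  have "(\<Union>i. A i) = space M"
  proof (intro equalityI subsetI)
    fix x assume x: "x \<in> space M"
    obtain d where "d \<in> D" "d \<in> ball (g x) (r / 2)" using D(2)[of "ball (g x) (r / 2)"] \<open>0 < r\<close> by auto
    moreover then obtain i where "d = from_nat_into D i"
      using from_nat_into_surj[OF D(1)] by metis
    ultimately show "x \<in> (\<Union>i. A i)" using x by (auto simp: A_def dist_commute)
  qed (auto simp: A_def)
  then have un: "(\<Union>n. \<Union>i\<le>n. A i) = space M" by auto
  have "\<exists>n. 1 - e < measure M (\<Union>i\<le>n. A i)"
    by (rule Lim_measure_incseq_less)
      (use un \<open>0 < e\<close> in \<open>auto simp: incseq_def prob_space intro: order_trans\<close>)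
  then obtain n where n: "1 - e < measure M (\<Union>i\<le>n. A i)" by blast
  show ?thesis
    unfolding almost_partition_def
  proof (intro exI[of _ "A ` {..n}"] conjI ballI)
    fix B x y assume "B \<in> A ` {..n}" "x \<in> B" "y \<in> B"
    then show "dist (g x) (g y) < r" unfolding A_def using dist_triangle_half_r by blast
  qed (use n in auto)
qed

lemma (in prob_space) almost_partition_finite_family:
  fixes g :: "nat \<Rightarrow> 'a \<Rightarrow> 'b::{metric_space, second_countable_topology}"
  assumes [measurable]: "\<And>i. g i \<in> borel_measurable M" and "0 < e" "0 < r"
  shows "almost_partition M e (\<lambda>x y. \<forall>i<N. dist (g i x) (g i y) < r)"
  using \<open>0 < e\<close>
proof (induction N arbitrary: e)
  case 0
  then show ?case
    unfolding almost_partition_def by (intro exI[of _ "{space M}"]) (auto simp: prob_space)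
next
  case (Suc N)
  have "almost_partition M (e / 2 + e / 2)
      (\<lambda>x y. (\<forall>i<N. dist (g i x) (g i y) < r) \<and> dist (g N x) (g N y) < r)"
    using Suc \<open>0 < r\<close> by (intro almost_partition_conj almost_partition_measurable) auto
  then show ?case by (rule almost_partition_mono) (auto simp: less_Suc_eq)
qed

section \<open>From finite covers to compact sets\<close>

text \<open>After the pieces are made disjoint and shrunk to closed, hence compact, sets, a Lebesgue
  number forces sufficiently close points of the union into the same piece.\<close>

lemma almost_partition_compact:
  fixes M :: "'a::metric_space measure"
  assumes "prob_space M" and cpt: "compact (UNIV :: 'a set)" and sets_M: "sets M = sets borel"
    and "almost_partition M e P"
  shows "\<exists>K. compact K \<and> 1 - e < measure M K \<and>
    (\<exists>\<delta>>0. \<forall>x\<in>K. \<forall>y\<in>K. dist x y < \<delta> \<longrightarrow> P x y)"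
proof -
  interpret prob_space M by fact
  obtain \<A> where \<A>: "finite \<A>" "\<A> \<subseteq> sets M" "1 - e < measure M (\<Union>\<A>)"
    "\<And>A x y. A \<in> \<A> \<Longrightarrow> x \<in> A \<Longrightarrow> y \<in> A \<Longrightarrow> P x y"
    using assms(4) unfolding almost_partition_def by blast
  obtain A :: "nat \<Rightarrow> 'a set" and k where "\<A> = A ` {i. i < k}"
    using finite_imp_nat_seg_image_inj_on[OF \<A>(1)] by blast
  then have A: "\<A> = A ` {..<k}" by (simp add: lessThan_def)
  define D where "D = disjointed (\<lambda>i. if i < k then A i else {})"
  have D_sets: "D i \<in> sets M" for i
    using \<A>(2) A sets.range_disjointed_sets[of "\<lambda>i. if i < k then A i else {}" M]
    unfolding D_def by (auto simp: image_subset_iff)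
  have D_disj: "disjoint_family D" unfolding D_def by (rule disjoint_family_disjointed)
  have D_sub: "D i \<subseteq> A i" if "i < k" for i
    using disjointed_subset[of "\<lambda>i. if i < k then A i else {}" i] that by (simp add: D_def)
  have D_empty: "D i = {}" if "\<not> i < k" for i
    using disjointed_subset[of "\<lambda>i. if i < k then A i else {}" i] that by (simp add: D_def)
  have D_Un: "(\<Union>i<k. D i) = \<Union>\<A>"
  proof -
    have "(\<Union>i<k. D i) = (\<Union>i. D i)" using D_empty by blast
    also have "\<dots> = \<Union>\<A>" unfolding D_def UN_disjointed_eq A by auto
    finally show ?thesis .
  qed
  \<comment> \<open>The surplus measure is cut into \<open>k + 1\<close> shares: the
    \<open>k\<close> pieces lose less than one share each, and the spare one keeps the inequality
    strict, also when \<open>k = 0\<close>.\<close>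
  define s where "s = (measure M (\<Union>\<A>) - (1 - e)) / Suc k"
  have s: "0 < s" unfolding s_def using \<A>(3) by simp
  have "\<exists>C. closed C \<and> C \<subseteq> D i \<and> measure M (D i) - s < measure M C" for i
    using closed_inner_regular[OF finite_measure_axioms sets_M D_sets s] .
  then obtain C where C: "\<And>i. closed (C i)" "\<And>i. C i \<subseteq> D i" "\<And>i. measure M (D i) - s < measure M (C i)"
    by metis
  define K where "K = (\<Union>i<k. C i)"
  have "closed K" unfolding K_def by (intro closed_UN) (auto simp: C)
  then have K: "compact K" using closed_Int_compact[OF _ cpt] by simp
  have C_disj: "disjoint_family C"
    using D_disj C(2) unfolding disjoint_family_on_def by blast
  have "measure M (\<Union>\<A>) = (\<Sum>i<k. measure M (D i))"
    unfolding D_Un[symmetric]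
    by (rule finite_measure_finite_Union) (use D_sets D_disj in \<open>auto intro: disjoint_family_on_mono\<close>)
  also have "\<dots> \<le> (\<Sum>i<k. measure M (C i) + s)"
    by (intro sum_mono) (use C(3) in \<open>auto simp: less_imp_le diff_less_eq\<close>)
  also have "\<dots> = measure M K + k * s"
    unfolding K_def
    by (subst finite_measure_finite_Union)
      (use C(1) C_disj in \<open>auto simp: sets_M sum.distrib intro: disjoint_family_on_mono\<close>)
  also have "\<dots> < measure M K + Suc k * s" using s by (simp add: algebra_simps)
  also have "Suc k * s = measure M (\<Union>\<A>) - (1 - e)" by (simp add: s_def)
  finally have "1 - e < measure M K" by simp
  moreover have "\<exists>\<delta>>0. \<forall>x\<in>K. \<forall>y\<in>K. dist x y < \<delta> \<longrightarrow> P x y"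
  proof -
    \<comment> \<open>Removing all other compact pieces leaves an open set that meets
      \<open>K\<close> only inside \<open>C i\<close>. By disjointness these sets cover
      \<open>K\<close>, and \<open>\<delta>\<close> is a Lebesgue number of this cover.\<close>
    define U where "U i = - (\<Union>j\<in>{..<k} - {i}. C j)" for i
    have KU: "K \<inter> U i \<subseteq> C i" for i by (auto simp: K_def U_def)
    have U_open: "open (U i)" for i unfolding U_def by (intro open_Compl closed_UN) (auto simp: C)
    have "K \<subseteq> \<Union>(U ` {..<k})"
      using C_disj unfolding K_def U_def disjoint_family_on_def by blast
    then obtain \<delta> where \<delta>: "0 < \<delta>" "\<And>x. x \<in> K \<Longrightarrow> \<exists>G\<in>U ` {..<k}. ball x \<delta> \<subseteq> G"
      by (rule Heine_Borel_lemma[OF K]) (use U_open in auto)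
    have "P x y" if xy: "x \<in> K" "y \<in> K" "dist x y < \<delta>" for x y
    proof -
      obtain i where i: "i < k" "ball x \<delta> \<subseteq> U i" using \<delta>(2)[OF xy(1)] by auto
      then have "x \<in> U i" "y \<in> U i" using xy \<delta>(1) by auto
      then have "x \<in> A i" "y \<in> A i" using KU xy C(2) D_sub[OF i(1)] by blast+
      then show ?thesis using \<A>(4)[of "A i"] A i(1) by blast
    qed
    then show ?thesis using \<delta>(1) by blast
  qed
  ultimately show ?thesis using K by blast
qed

text \<open>One \<open>K\<close> must serve every \<open>\<epsilon>\<close>, so compact sets for a
  geometric sequence of errors with sum \<open>\<tau> / 2\<close> are intersected. Since
  \<open>Q\<close> is an arbitrary family, the conclusion offers a member of this sequence below
  \<open>\<epsilon>\<close> instead of \<open>\<epsilon>\<close> itself.\<close>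

lemma almost_partition_imp_compact:
  fixes M :: "'a::metric_space measure"
  assumes "prob_space M" and cpt: "compact (UNIV :: 'a set)" and sets_M: "sets M = sets borel"
    and ap: "\<And>e. 0 < e \<Longrightarrow> almost_partition M e (Q e)" and "0 < \<tau>"
  shows "\<exists>K. compact K \<and> 1 - \<tau> < measure M K \<and>
    (\<forall>\<epsilon>>0. \<exists>e. 0 < e \<and> e < \<epsilon> \<and> (\<exists>\<delta>>0. \<forall>x\<in>K. \<forall>y\<in>K. dist x y < \<delta> \<longrightarrow> Q e x y))"
proof -
  interpret prob_space M by fact
  define e where "e l = \<tau> / 2 * (1/2) ^ Suc l" for l :: nat
  have e_pos: "0 < e l" for l using \<open>0 < \<tau>\<close> by (simp add: e_def)
  have "\<exists>K. compact K \<and> 1 - e l < measure M K \<and> (\<exists>\<delta>>0. \<forall>x\<in>K. \<forall>y\<in>K. dist x y < \<delta> \<longrightarrow> Q (e l) x y)" for l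
    using almost_partition_compact[OF prob_space_axioms cpt sets_M ap[OF e_pos]] .
  then obtain K where K: "\<And>l. compact (K l)" "\<And>l. 1 - e l < measure M (K l)"
      "\<And>l. \<exists>\<delta>>0. \<forall>x\<in>K l. \<forall>y\<in>K l. dist x y < \<delta> \<longrightarrow> Q (e l) x y"
    by metis
  have space_M: "space M = UNIV" using sets_eq_imp_space_eq[OF sets_M] by simp
  have K_sets: "K l \<in> sets M" for l using compact_imp_closed[OF K(1)] by (simp add: sets_M)
  have closed: "closed (\<Inter>l. K l)" using compact_imp_closed[OF K(1)] by blast
  then have "compact (\<Inter>l. K l)" using closed_Int_compact[OF _ cpt] by simp
  moreover have "1 - \<tau> < measure M (\<Inter>l. K l)"
  proof -
    have geo: "e sums (\<tau> / 2 * 1)"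
      unfolding e_def using power_half_series by (rule sums_mult)
    have compl: "measure M (- K l) \<le> e l" for l
      using prob_compl[OF K_sets[of l]] K(2)[of l] by (simp add: space_M Compl_eq_Diff_UNIV)
    have summ: "summable (\<lambda>l. measure M (- K l))"
      by (rule summable_comparison_test[OF _ sums_summable[OF geo]])
        (auto intro!: exI[of _ 0] compl)
    have "1 - measure M (\<Inter>l. K l) = measure M (- (\<Inter>l. K l))"
      using prob_compl[of "\<Inter>l. K l"] closed by (simp add: space_M sets_M Compl_eq_Diff_UNIV)
    also have "\<dots> = measure M (\<Union>l. - K l)" by (simp add: Compl_INT)
    also have "\<dots> \<le> (\<Sum>l. measure M (- K l))"
      by (rule finite_measure_subadditive_countably)
        (use summ sets.compl_sets[OF K_sets] in \<open>auto simp: space_M Compl_eq_Diff_UNIV\<close>)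
    also have "\<dots> \<le> \<tau> / 2"
      using suminf_le[OF compl summ sums_summable[OF geo]] sums_unique[OF geo] by simp
    finally show ?thesis using \<open>0 < \<tau>\<close> by simp
  qed
  moreover have "\<exists>e'. 0 < e' \<and> e' < \<epsilon> \<and>
      (\<exists>\<delta>>0. \<forall>x\<in>(\<Inter>l. K l). \<forall>y\<in>(\<Inter>l. K l). dist x y < \<delta> \<longrightarrow> Q e' x y)" if "0 < \<epsilon>" for \<epsilon>
  proof -
    have "e \<longlonglongrightarrow> \<tau> / 2 * 0"
      unfolding e_def by (intro tendsto_intros LIMSEQ_Suc[OF LIMSEQ_realpow_zero]) auto
    then have "\<forall>\<^sub>F l in sequentially. e l < \<epsilon>" using that by (auto dest: order_tendstoD(2))
    then obtain l where "e l < \<epsilon>" by (auto simp: eventually_sequentially)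
    moreover obtain \<delta> where "0 < \<delta>" "\<And>x y. x \<in> K l \<Longrightarrow> y \<in> K l \<Longrightarrow> dist x y < \<delta> \<Longrightarrow> Q (e l) x y"
      using K(3)[of l] by blast
    ultimately show ?thesis using e_pos[of l] by (intro exI[of _ "e l"]) auto
  qed
  ultimately show ?thesis by blast
qed

section \<open>Limit superior of sets and disjoint families\<close>

text \<open>Reverse Fatou for sets: the limit superior is a decreasing intersection of tail unions,
  each at least as large as some \<open>E n\<close> of measure at least \<open>c\<close>.\<close>

lemma (in finite_measure) measure_frequently_ge:
  assumes E: "\<And>n. E n \<in> sets M" and freq: "\<exists>\<^sub>F n in sequentially. c \<le> measure M (E n)"
  shows "c \<le> measure M {x \<in> space M. \<exists>\<^sub>F n in sequentially. x \<in> E n}"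
proof -
  have *: "{x \<in> space M. \<exists>\<^sub>F n in sequentially. x \<in> E n} = (\<Inter>m. \<Union>n\<in>{m..}. E n)"
    using sets.sets_into_space[OF E] by (fastforce simp: frequently_sequentially)
  have "(\<lambda>m. measure M (\<Union>n\<in>{m..}. E n)) \<longlonglongrightarrow> measure M (\<Inter>m. \<Union>n\<in>{m..}. E n)"
    by (rule finite_Lim_measure_decseq) (use E in \<open>fastforce simp: decseq_def\<close>)+
  moreover have "c \<le> measure M (\<Union>n\<in>{m..}. E n)" for m
  proof -
    obtain n where "n \<ge> m" "c \<le> measure M (E n)" using freq by (auto simp: frequently_sequentially)
    moreover have "measure M (E n) \<le> measure M (\<Union>n\<in>{m..}. E n)"
      by (rule finite_measure_mono) (use E \<open>n \<ge> m\<close> in auto)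
    ultimately show ?thesis by linarith
  qed
  ultimately show ?thesis unfolding * by (intro LIMSEQ_le_const) auto
qed

text \<open>A maximal pairwise disjoint subfamily has at most \<open>1 / \<eta>\<close> members.\<close>

lemma (in prob_space) finite_intersecting_subfamily:
  assumes B: "\<And>x. x \<in> G \<Longrightarrow> B x \<in> sets M" and "0 < \<eta>" and ge: "\<And>x. x \<in> G \<Longrightarrow> \<eta> \<le> measure M (B x)"
  shows "\<exists>S. finite S \<and> S \<subseteq> G \<and> (\<forall>y\<in>G. \<exists>x\<in>S. B x \<inter> B y \<noteq> {})"
proof -
  define P where "P S \<longleftrightarrow> finite S \<and> S \<subseteq> G \<and> disjoint_family_on B S" for S
  have bound: "card S \<le> nat \<lceil>1 / \<eta>\<rceil>" if "P S" for S
  proof -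
    have "\<eta> * real (card S) \<le> (\<Sum>x\<in>S. measure M (B x))"
      using sum_bounded_below[of S \<eta> "\<lambda>x. measure M (B x)"] that ge
      by (auto simp: P_def mult.commute)
    also have "\<dots> = measure M (\<Union>x\<in>S. B x)"
      by (rule finite_measure_finite_Union[symmetric]) (use that B in \<open>auto simp: P_def\<close>)
    also have "\<dots> \<le> 1" by (rule prob_le_1)
    finally have "real (card S) \<le> 1 / \<eta>" using \<open>0 < \<eta>\<close> by (simp add: field_simps)
    then show ?thesis by linarith
  qed
  have "P {}" by (simp add: P_def disjoint_family_on_def)
  then obtain S where S: "P S" "\<And>S'. P S' \<Longrightarrow> card S' \<le> card S"
    using ex_has_greatest_nat[of P "{}" card "Suc (nat \<lceil>1 / \<eta>\<rceil>)"] bound by (auto simp: less_Suc_eq_le)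
  have "\<exists>x\<in>S. B x \<inter> B y \<noteq> {}" if y: "y \<in> G" for y
  proof (rule ccontr)
    assume neg: "\<not> ?thesis"
    \<comment> \<open>Nonemptiness excludes \<open>y\<close> from \<open>S\<close>, since otherwise
      \<open>B y\<close> would meet itself; so inserting \<open>y\<close> really increases the
      cardinality.\<close>
    have "B y \<noteq> {}" using ge[OF y] \<open>0 < \<eta>\<close> by force
    then have "y \<notin> S" using neg by auto
    moreover have "P (insert y S)"
      using S(1) y neg by (auto simp: P_def disjoint_family_on_def)
    ultimately show False using S(1) S(2)[of "insert y S"] by (simp add: P_def)
  qed
  then show ?thesis using S(1) by (auto simp: P_def)
qed

section \<open>Orbit averages\<close>

lemma orbit_avg_commute: "orbit_avg T f n x y = orbit_avg T f n y x"
  by (simp add: orbit_avg_def norm_minus_commute)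

lemma orbit_avg_triangle: "orbit_avg T f n x z \<le> orbit_avg T f n x y + orbit_avg T f n y z"
proof -
  have "cmod (f ((T ^^ i) x) - f ((T ^^ i) z)) \<le>
      cmod (f ((T ^^ i) x) - f ((T ^^ i) y)) + cmod (f ((T ^^ i) y) - f ((T ^^ i) z))" for i
    using norm_triangle_ineq[of "f ((T ^^ i) x) - f ((T ^^ i) y)" "f ((T ^^ i) y) - f ((T ^^ i) z)"]
    by simp
  then show ?thesis
    unfolding orbit_avg_def
    by (simp add: add_divide_distrib[symmetric] sum.distrib[symmetric] divide_right_mono sum_mono)
qed

lemma orbit_avg_max_less_iff:
  "1 \<le> n \<Longrightarrow> orbit_avg_max T f n x y < e \<longleftrightarrow> (\<forall>k\<in>{1..n}. orbit_avg T f k x y < e)"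
  by (simp add: orbit_avg_max_def)

text \<open>In \<open>enat\<close>, being at most \<open>C\<close> is being below
  \<open>C + 1\<close>, and a strict bound on an infimum yields a witness.\<close>

lemma cover_number_le_iff:
  "cover_number \<mu> \<rho> \<epsilon> \<le> enat C \<longleftrightarrow>
    (\<exists>F. finite F \<and> card F \<le> C \<and> 1 - \<epsilon> < measure \<mu> (\<Union>x\<in>F. {y. \<rho> x y < \<epsilon>}))"
proof -
  have "cover_number \<mu> \<rho> \<epsilon> \<le> enat C \<longleftrightarrow> cover_number \<mu> \<rho> \<epsilon> < enat (Suc C)"
    by (cases "cover_number \<mu> \<rho> \<epsilon>") auto
  also have "\<dots> \<longleftrightarrow> (\<exists>F. finite F \<and> card F \<le> C \<and> 1 - \<epsilon> < measure \<mu> (\<Union>x\<in>F. {y. \<rho> x y < \<epsilon>}))"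
    unfolding cover_number_def INF_less_iff by auto
  finally show ?thesis .
qed

lemma almost_partition_iff_indexed:
  "almost_partition M e (\<lambda>x y. \<forall>n\<ge>1. orbit_avg T f n x y < r) \<longleftrightarrow>
    (\<exists>k\<ge>1. \<exists>A :: nat \<Rightarrow> 'a set. (\<forall>i\<in>{1..k}. A i \<in> sets M) \<and>
      measure M (\<Union>i\<in>{1..k}. A i) > 1 - e \<and>
      (\<forall>i\<in>{1..k}. \<forall>x\<in>A i. \<forall>y\<in>A i. \<forall>n\<ge>1. orbit_avg_max T f n x y < r))"
    (is "?L \<longleftrightarrow> ?R")
proof
  assume ?L
  then obtain \<A> where \<A>: "finite \<A>" "\<A> \<subseteq> sets M" "1 - e < measure M (\<Union>\<A>)"
    "\<forall>A\<in>\<A>. \<forall>x\<in>A. \<forall>y\<in>A. \<forall>n\<ge>1. orbit_avg T f n x y < r"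
    unfolding almost_partition_def by (elim exE conjE)
  \<comment> \<open>The added empty set guarantees at least one index, even when \<open>\<A>\<close>
    is empty, as can happen for \<open>e > 1\<close>.\<close>
  let ?\<B> = "insert {} \<A>"
  obtain A where "bij_betw A {1..card ?\<B>} ?\<B>"
    using ex_bij_betw_nat_finite_1[of ?\<B>] \<A>(1) by blast
  then have A: "A ` {1..card ?\<B>} = ?\<B>" by (rule bij_betw_imp_surj_on)
  show ?R
  proof (intro exI conjI ballI allI impI)
    show "1 \<le> card ?\<B>" using \<A>(1) by (simp add: Suc_le_eq card_gt_0_iff)
    show "measure M (\<Union>i\<in>{1..card ?\<B>}. A i) > 1 - e" unfolding A using \<A>(3) by simp
    fix i assume "i \<in> {1..card ?\<B>}"
    then have Ai: "A i \<in> ?\<B>" using A by blast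
    then show "A i \<in> sets M" using \<A>(2) by auto
    fix x y n assume "x \<in> A i" "y \<in> A i" "(1::nat) \<le> n"
    then show "orbit_avg_max T f n x y < r"
      using \<A>(4) Ai by (auto simp: orbit_avg_max_less_iff)
  qed
next
  assume ?R
  then obtain k and A :: "nat \<Rightarrow> 'a set" where A: "\<forall>i\<in>{1..k}. A i \<in> sets M"
    "measure M (\<Union>i\<in>{1..k}. A i) > 1 - e"
    "\<forall>i\<in>{1..k}. \<forall>x\<in>A i. \<forall>y\<in>A i. \<forall>n\<ge>1. orbit_avg_max T f n x y < r"
    by (elim exE conjE)
  have "orbit_avg T f n x y < r" if "i \<in> {1..k}" "x \<in> A i" "y \<in> A i" "1 \<le> n" for i x y n
    using A(3)[rule_format, OF that] that(4) by (auto simp: orbit_avg_max_less_iff)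
  then show ?L
    unfolding almost_partition_def using A(1,2) by (intro exI[of _ "A ` {1..k}"]) auto
qed

section \<open>Measurability and convergence of orbit averages\<close>

locale complex_observable = measure_preserving M T for M :: "'a measure" and T :: "'a \<Rightarrow> 'a" +
  fixes f :: "'a \<Rightarrow> complex"
  assumes space_UNIV: "space M = UNIV" and f_integrable: "integrable M f"
begin

lemma f_measurable [measurable]: "f \<in> borel_measurable M"
  using f_integrable by (rule borel_measurable_integrable)

lemma orbit_avg_measurable [measurable]: "(\<lambda>y. orbit_avg T f n x y) \<in> borel_measurable M"
  unfolding orbit_avg_def by measurable

lemma orbit_avg_measurable_pair [measurable]:
  "(\<lambda>(x, y). orbit_avg T f n x y) \<in> borel_measurable (M \<Otimes>\<^sub>M M)"
  unfolding orbit_avg_def by measurable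

lemma ball_sets: "{y. orbit_avg T f n x y < r} \<in> sets M"
proof -
  have "{y \<in> space M. orbit_avg T f n x y < r} \<in> sets M" by measurable
  then show ?thesis by (simp add: space_UNIV)
qed

lemma eventual_ball_sets: "{y. \<forall>\<^sub>F n in sequentially. orbit_avg T f n x y < r} \<in> sets M"
proof -
  have "{y \<in> space M. \<forall>\<^sub>F n in sequentially. orbit_avg T f n x y < r} \<in> sets M"
    unfolding eventually_sequentially by measurable
  then show ?thesis by (simp add: space_UNIV)
qed

text \<open>On the product space these are Birkhoff averages of a single integrable function under a
  map preserving the product measure. Fubini turns almost every pair into almost every
  \<open>y\<close> for almost every centre \<open>x\<close>.\<close>

lemma orbit_avg_convergence:
  "AE x in M. AE y in M. \<forall>a b. a < b \<longrightarrow>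
    (\<exists>\<^sub>F n in sequentially. orbit_avg T f n x y < a) \<longrightarrow>
    (\<forall>\<^sub>F n in sequentially. orbit_avg T f n x y < b)"
proof -
  interpret MM: pair_prob_space M M ..
  let ?T = "\<lambda>(x, y). (T x, T y)" and ?h = "\<lambda>(x, y). cmod (f x - f y)"
  have "distr (M \<Otimes>\<^sub>M M) (M \<Otimes>\<^sub>M M) ?T = distr M M T \<Otimes>\<^sub>M distr M M T"
    by (rule pair_measure_distr[symmetric]) (simp_all add: distr_T sigma_finite_measure_axioms)
  then interpret P: measure_preserving "M \<Otimes>\<^sub>M M" ?T
    by unfold_locales (simp_all add: distr_T)
  have f1: "integrable (M \<Otimes>\<^sub>M M) (\<lambda>p. f (fst p))"
    using f_integrable integrable_distr_eq[of fst "M \<Otimes>\<^sub>M M" M f] by (simp add: distr_pair_fst)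
  have f2: "integrable (M \<Otimes>\<^sub>M M) (\<lambda>p. f (snd p))"
    using MM.integrable_product_swap[OF f1] by (simp add: case_prod_beta')
  have h: "integrable (M \<Otimes>\<^sub>M M) ?h"
    using integrable_norm[OF Bochner_Integration.integrable_diff[OF f1 f2]]
    by (simp add: case_prod_beta')
  have funpow: "(?T ^^ i) (x, y) = ((T ^^ i) x, (T ^^ i) y)" for i x y
    by (induction i) auto
  have "P.birkhoff_sum ?h n (x, y) / real n = orbit_avg T f n x y" for n x y
    by (simp add: P.birkhoff_sum_def orbit_avg_def funpow)
  then show ?thesis
    using MM.AE_pair[OF P.birkhoff_convergence[OF h]] by simp
qed

text \<open>Half of the error buys a common time \<open>N\<close> after which the averages to a
  centre stay below \<open>r\<close>; passing through the centre doubles \<open>r\<close>. The other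
  half buys small oscillation of the first \<open>N\<close> iterates, which settles all
  \<open>n < N\<close>.\<close>

lemma almost_partition_if_eventually_close:
  assumes "0 < e" "0 < r" and F: "finite F" and G: "G \<in> sets M" "1 - e < measure M G"
    and sub: "G \<subseteq> (\<Union>x\<in>F. {y. \<forall>\<^sub>F n in sequentially. orbit_avg T f n x y < r})"
  shows "almost_partition M (2 * e) (\<lambda>x y. \<forall>n\<ge>1. orbit_avg T f n x y < 2 * r)"
proof -
  define A where "A N x = {y. \<forall>n\<ge>N. orbit_avg T f n x y < r}" for N x
  have A_sets: "A N x \<in> sets M" for N x
  proof -
    have "{y \<in> space M. \<forall>n\<ge>N. orbit_avg T f n x y < r} \<in> sets M" by measurable
    then show ?thesis by (simp add: space_UNIV A_def)
  qed
  have "G \<subseteq> (\<Union>N. \<Union>x\<in>F. A N x)"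
    using sub unfolding A_def eventually_sequentially by blast
  then have "measure M G \<le> measure M (\<Union>N. \<Union>x\<in>F. A N x)"
    by (rule finite_measure_mono) (use A_sets F in auto)
  then have "\<exists>N. 1 - e < measure M (\<Union>x\<in>F. A N x)"
    using G(2) A_sets F
    by (intro Lim_measure_incseq_less) (auto simp: incseq_def A_def)
  then obtain N where N: "1 - e < measure M (\<Union>x\<in>F. A N x)" by blast
  have late: "almost_partition M e (\<lambda>x y. \<forall>n\<ge>N. orbit_avg T f n x y < 2 * r)"
    unfolding almost_partition_def
  proof (intro exI[of _ "A N ` F"] conjI ballI allI impI)
    fix B y z n assume "B \<in> A N ` F" "y \<in> B" "z \<in> B" "N \<le> n"
    then obtain x where "orbit_avg T f n x y < r" "orbit_avg T f n x z < r" by (auto simp: A_def)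
    then show "orbit_avg T f n y z < 2 * r"
      using orbit_avg_triangle[of T f n y z x] orbit_avg_commute[of T f n x y] by simp
  qed (use N F A_sets in auto)
  have early: "almost_partition M e
      (\<lambda>x y. \<forall>i<N. dist ((\<lambda>x. f ((T ^^ i) x)) x) ((\<lambda>x. f ((T ^^ i) x)) y) < r)"
    by (rule almost_partition_finite_family) (use \<open>0 < e\<close> \<open>0 < r\<close> in auto)
  show ?thesis
  proof (rule almost_partition_mono[OF almost_partition_conj[OF late early]])
    fix x y
    assume *: "(\<forall>n\<ge>N. orbit_avg T f n x y < 2 * r) \<and>
      (\<forall>i<N. dist ((\<lambda>x. f ((T ^^ i) x)) x) ((\<lambda>x. f ((T ^^ i) x)) y) < r)"
    show "\<forall>n\<ge>1. orbit_avg T f n x y < 2 * r"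
    proof (intro allI impI)
      fix n :: nat assume "1 \<le> n"
      show "orbit_avg T f n x y < 2 * r"
      proof (cases "N \<le> n")
        case False
        then have "(\<Sum>i<n. cmod (f ((T ^^ i) x) - f ((T ^^ i) y))) \<le> of_nat (card {..<n}) * r"
          using * by (intro sum_bounded_above) (auto simp: dist_norm less_imp_le)
        then have "orbit_avg T f n x y \<le> r"
          using \<open>1 \<le> n\<close> by (simp add: orbit_avg_def field_simps)
        then show ?thesis using \<open>0 < r\<close> by simp
      qed (use * in blast)
    qed
  qed simp
qed

section \<open>Bounded complexity gives finite covers\<close>

text \<open>The balls are sections of a measurable subset of the product, so their measure depends
  measurably on the centre.\<close>

lemma heavy_ball_centres_sets: "{x. c \<le> measure M {y. orbit_avg T f n x y < r}} \<in> sets M"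
proof -
  have "{p \<in> space (M \<Otimes>\<^sub>M M). (case p of (x, y) \<Rightarrow> orbit_avg T f n x y) < r} \<in> sets (M \<Otimes>\<^sub>M M)"
    by measurable
  from measurable_emeasure_Pair[OF this]
  have "(\<lambda>x. emeasure M {y. orbit_avg T f n x y < r}) \<in> borel_measurable M"
    by (simp add: space_pair_measure space_UNIV vimage_def)
  then have [measurable]: "(\<lambda>x. measure M {y. orbit_avg T f n x y < r}) \<in> borel_measurable M"
    unfolding measure_def by measurable
  have "{x \<in> space M. c \<le> measure M {y. orbit_avg T f n x y < r}} \<in> sets M" by measurable
  then show ?thesis by (simp add: space_UNIV)
qed

text \<open>Among at most \<open>C\<close> balls of radius \<open>e\<close>, those of measure below \<open>e / C\<close> cover at most \<open>e\<close>; the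
  remaining points are centres of balls of radius \<open>2 * e\<close> and measure at least \<open>e / C\<close>.\<close>

lemma measure_heavy_ball_centres:
  assumes "0 < e" "1 \<le> C" "finite F" "card F \<le> C"
    and cover: "1 - e < measure M (\<Union>x\<in>F. {y. orbit_avg T f n x y < e})"
  shows "1 - 2 * e \<le> measure M {x. e / C \<le> measure M {y. orbit_avg T f n x y < 2 * e}}"
proof -
  let ?B = "\<lambda>x r. {y. orbit_avg T f n x y < r}" and ?\<eta> = "e / C"
  define F1 where "F1 = {x \<in> F. measure M (?B x e) < ?\<eta>}"
  have F1: "finite F1" "card F1 \<le> C"
    using \<open>finite F\<close> \<open>card F \<le> C\<close> card_mono[of F F1] by (auto simp: F1_def)
  have light: "measure M (\<Union>x\<in>F1. ?B x e) \<le> e"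
  proof -
    have "measure M (\<Union>x\<in>F1. ?B x e) \<le> (\<Sum>x\<in>F1. measure M (?B x e))"
      by (rule finite_measure_subadditive_finite) (use F1 ball_sets in auto)
    also have "\<dots> \<le> of_nat (card F1) * ?\<eta>"
      by (rule sum_bounded_above) (auto simp: F1_def)
    also have "\<dots> \<le> real C * ?\<eta>"
      using F1(2) \<open>0 < e\<close> by (intro mult_right_mono) auto
    finally show ?thesis using \<open>1 \<le> C\<close> by simp
  qed
  have "(\<Union>x\<in>F. ?B x e) \<subseteq> {x. ?\<eta> \<le> measure M (?B x (2 * e))} \<union> (\<Union>x\<in>F1. ?B x e)"
  proof
    fix y assume "y \<in> (\<Union>x\<in>F. ?B x e)"
    then obtain x where x: "x \<in> F" "orbit_avg T f n x y < e" by auto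
    show "y \<in> {x. ?\<eta> \<le> measure M (?B x (2 * e))} \<union> (\<Union>x\<in>F1. ?B x e)"
    proof (cases "x \<in> F1")
      case False
      then have "?\<eta> \<le> measure M (?B x e)" using x by (auto simp: F1_def)
      also have "\<dots> \<le> measure M (?B y (2 * e))"
      proof (rule finite_measure_mono[OF _ ball_sets], safe)
        fix z assume "orbit_avg T f n x z < e"
        then show "orbit_avg T f n y z < 2 * e"
          using orbit_avg_triangle[of T f n y z x] orbit_avg_commute[of T f n x y] x(2) by simp
      qed
      finally show ?thesis by simp
    qed (use x in auto)
  qed
  then have "measure M (\<Union>x\<in>F. ?B x e) \<le>
      measure M ({x. ?\<eta> \<le> measure M (?B x (2 * e))} \<union> (\<Union>x\<in>F1. ?B x e))"
    by (intro finite_measure_mono sets.Un heavy_ball_centres_sets sets.finite_UN F1 ball_sets)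
  also have "\<dots> \<le> measure M {x. ?\<eta> \<le> measure M (?B x (2 * e))} + measure M (\<Union>x\<in>F1. ?B x e)"
    by (intro measure_Un_le heavy_ball_centres_sets sets.finite_UN F1 ball_sets)
  finally show ?thesis using cover light by simp
qed

text \<open>The radius grows from \<open>e\<close> to \<open>2 * e\<close> for heavy balls,
  \<open>3 * e\<close> for balls that hold eventually in time, \<open>6 * e\<close> for the enlarged
  disjoint family and \<open>12 * e\<close> for the diameter of the pieces.\<close>

lemma almost_partition_if_bounded_covers:
  assumes "0 < e" "1 \<le> C"
    and cover: "\<And>n. 1 \<le> n \<Longrightarrow> \<exists>F. finite F \<and> card F \<le> C \<and>
      1 - e < measure M (\<Union>x\<in>F. {y. orbit_avg T f n x y < e})"
  shows "almost_partition M (6 * e) (\<lambda>x y. \<forall>n\<ge>1. orbit_avg T f n x y < 12 * e)"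
proof -
  let ?B = "\<lambda>n x r. {y. orbit_avg T f n x y < r}" and ?\<eta> = "e / C"
  define H where "H n = {x. ?\<eta> \<le> measure M (?B n x (2 * e))}" for n
  have H_sets: "H n \<in> sets M" for n
    unfolding H_def by (rule heavy_ball_centres_sets)
  have H: "1 - 2 * e \<le> measure M (H n)" if "1 \<le> n" for n
    using cover[OF that] measure_heavy_ball_centres[OF \<open>0 < e\<close> \<open>1 \<le> C\<close>] unfolding H_def by blast
  \<comment> \<open>Heaviness at each single time becomes heaviness at infinitely many times,
    without loss in the bound \<open>1 - 2 * e\<close>.\<close>
  define G where "G = {x \<in> space M. \<exists>\<^sub>F n in sequentially. x \<in> H n}"
  have "\<forall>\<^sub>F n in sequentially. 1 - 2 * e \<le> measure M (H n)"
    using H by (auto simp: eventually_sequentially)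
  then have G: "1 - 2 * e \<le> measure M G"
    unfolding G_def by (intro measure_frequently_ge H_sets eventually_frequently) auto
  have G_sets: "G \<in> sets M"
  proof -
    note [measurable] = H_sets
    show ?thesis unfolding G_def frequently_sequentially by measurable
  qed
  \<comment> \<open>\<open>N\<close> is a null set of centres; from every centre outside it, the
    averages to almost every point converge.\<close>
  obtain N where N: "N \<in> null_sets M"
    and conv: "\<And>x. x \<notin> N \<Longrightarrow> AE y in M. \<forall>a b. a < b \<longrightarrow>
      (\<exists>\<^sub>F n in sequentially. orbit_avg T f n x y < a) \<longrightarrow>
      (\<forall>\<^sub>F n in sequentially. orbit_avg T f n x y < b)"
    using AE_E3[OF orbit_avg_convergence] by (auto simp: space_UNIV)
  have GN: "measure M (G - N) = measure M G"
    by (intro measure_Diff_null_set N G_sets)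
  let ?E = "\<lambda>x r. {y. \<forall>\<^sub>F n in sequentially. orbit_avg T f n x y < r}"
  \<comment> \<open>Points that are \<open>2 * e\<close>-close to \<open>x\<close> infinitely often
    have measure at least \<open>?\<eta>\<close>; convergence upgrades this to eventual closeness at
    the cost of radius \<open>3 * e\<close>.\<close>
  have ge: "?\<eta> \<le> measure M (?E x (3 * e))" if x: "x \<in> G - N" for x
  proof -
    have "?\<eta> \<le> measure M {y \<in> space M. \<exists>\<^sub>F n in sequentially. y \<in> ?B n x (2 * e)}"
      by (rule measure_frequently_ge) (use x ball_sets in \<open>auto simp: G_def H_def\<close>)
    also have "\<dots> \<le> measure M (?E x (3 * e))"
    proof (rule finite_measure_mono_AE[OF _ eventual_ball_sets])
      have "x \<notin> N" using x by simp
      from conv[OF this]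
      show "AE y in M. y \<in> {y \<in> space M. \<exists>\<^sub>F n in sequentially. y \<in> ?B n x (2 * e)} \<longrightarrow> y \<in> ?E x (3 * e)"
      proof (rule AE_mp, intro AE_I2 impI)
        fix y
        assume *: "\<forall>a b. a < b \<longrightarrow>
          (\<exists>\<^sub>F n in sequentially. orbit_avg T f n x y < a) \<longrightarrow>
          (\<forall>\<^sub>F n in sequentially. orbit_avg T f n x y < b)"
          and "y \<in> {y \<in> space M. \<exists>\<^sub>F n in sequentially. y \<in> ?B n x (2 * e)}"
        then have "\<exists>\<^sub>F n in sequentially. orbit_avg T f n x y < 2 * e" by simp
        moreover have "2 * e < 3 * e" using \<open>0 < e\<close> by simp
        ultimately have "\<forall>\<^sub>F n in sequentially. orbit_avg T f n x y < 3 * e"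
          using * by (elim allE impE)
        then show "y \<in> ?E x (3 * e)" by simp
      qed
    qed
    finally show ?thesis .
  qed
  have "0 < ?\<eta>" using \<open>0 < e\<close> \<open>1 \<le> C\<close> by simp
  have "\<exists>S. finite S \<and> S \<subseteq> G - N \<and> (\<forall>y\<in>G - N. \<exists>x\<in>S. ?E x (3 * e) \<inter> ?E y (3 * e) \<noteq> {})"
    by (rule finite_intersecting_subfamily[OF eventual_ball_sets \<open>0 < ?\<eta>\<close> ge])
  then obtain S where S: "finite S" "\<forall>y\<in>G - N. \<exists>x\<in>S. ?E x (3 * e) \<inter> ?E y (3 * e) \<noteq> {}"
    by (elim exE conjE)
  have "almost_partition M (2 * (3 * e)) (\<lambda>x y. \<forall>n\<ge>1. orbit_avg T f n x y < 2 * (6 * e))"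
  proof (rule almost_partition_if_eventually_close)
    show "finite S" by (rule S)
    show "G - N \<in> sets M" using G_sets N by auto
    show "1 - 3 * e < measure M (G - N)" using G GN \<open>0 < e\<close> by simp
    show "G - N \<subseteq> (\<Union>x\<in>S. ?E x (6 * e))"
    proof
      \<comment> \<open>The eventual balls about \<open>y\<close> and some \<open>x\<close> in
        \<open>S\<close> share a point \<open>z\<close>, through which the triangle inequality
        runs.\<close>
      fix y assume "y \<in> G - N"
      then obtain x z where x: "x \<in> S" and
        ev: "\<forall>\<^sub>F n in sequentially. orbit_avg T f n x z < 3 * e"
            "\<forall>\<^sub>F n in sequentially. orbit_avg T f n y z < 3 * e"
        using bspec[OF S(2), of y] by auto
      have "\<forall>\<^sub>F n in sequentially. orbit_avg T f n x y < 6 * e"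
        using ev
      proof eventually_elim
        case (elim n)
        then show ?case
          using orbit_avg_triangle[of T f n x y z] orbit_avg_commute[of T f n y z] by simp
      qed
      then show "y \<in> (\<Union>x\<in>S. ?E x (6 * e))" using x by blast
    qed
  qed (use \<open>0 < e\<close> in auto)
  then show ?thesis by simp
qed

lemma bounded_complexity_orbit_avg_imp_almost_partition:
  assumes "bounded_complexity M (orbit_avg T f)" "0 < \<epsilon>"
  shows "almost_partition M \<epsilon> (\<lambda>x y. \<forall>n\<ge>1. orbit_avg T f n x y < \<epsilon>)"
proof -
  \<comment> \<open>The factor 12 cancels the growth of the radius; the lost measure is then only
    \<open>\<epsilon> / 2\<close>.\<close>
  define e where "e = \<epsilon> / 12"
  have "0 < e" using \<open>0 < \<epsilon>\<close> by (simp add: e_def)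
  then obtain C where C: "1 \<le> C"
    "\<And>n. 1 \<le> n \<Longrightarrow> \<exists>F. finite F \<and> card F \<le> C \<and> 1 - e < measure M (\<Union>x\<in>F. {y. orbit_avg T f n x y < e})"
    using assms(1) unfolding bounded_complexity_def cover_number_le_iff by meson
  show ?thesis
    by (rule almost_partition_mono[OF almost_partition_if_bounded_covers[OF \<open>0 < e\<close> C]])
      (use \<open>0 < \<epsilon>\<close> in \<open>auto simp: e_def\<close>)
qed

lemma bounded_complexity_orbit_avg_if_max:
  assumes "bounded_complexity M (orbit_avg_max T f)"
  shows "bounded_complexity M (orbit_avg T f)"
  unfolding bounded_complexity_def cover_number_le_iff
proof (intro allI impI)
  fix e :: real assume "0 < e"
  then obtain C where C: "1 \<le> C"
    "\<And>n. 1 \<le> n \<Longrightarrow> \<exists>F. finite F \<and> card F \<le> C \<and> 1 - e < measure M (\<Union>x\<in>F. {y. orbit_avg_max T f n x y < e})"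
    using assms unfolding bounded_complexity_def cover_number_le_iff by meson
  have "\<exists>F. finite F \<and> card F \<le> C \<and> 1 - e < measure M (\<Union>x\<in>F. {y. orbit_avg T f n x y < e})"
    if n: "1 \<le> n" for n
  proof -
    obtain F where F: "finite F" "card F \<le> C" "1 - e < measure M (\<Union>x\<in>F. {y. orbit_avg_max T f n x y < e})"
      using C(2)[OF n] by blast
    note F(3)
    also have "measure M (\<Union>x\<in>F. {y. orbit_avg_max T f n x y < e}) \<le>
        measure M (\<Union>x\<in>F. {y. orbit_avg T f n x y < e})"
      by (rule finite_measure_mono)
        (use n F(1) ball_sets in \<open>auto simp: orbit_avg_max_less_iff intro!: sets.finite_UN\<close>)
    finally show ?thesis using F(1,2) by blast
  qed
  then show "\<exists>C\<ge>1. \<forall>n\<ge>1. \<exists>F. finite F \<and> card F \<le> C \<and>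
      1 - e < measure M (\<Union>x\<in>F. {y. orbit_avg T f n x y < e})"
    using C(1) by blast
qed

text \<open>One point from each nonempty piece serves as centre, and the pieces do not depend on
  \<open>n\<close>.\<close>

lemma bounded_complexity_max_if_almost_partition:
  assumes ap: "\<And>\<epsilon>. 0 < \<epsilon> \<Longrightarrow> almost_partition M \<epsilon> (\<lambda>x y. \<forall>n\<ge>1. orbit_avg T f n x y < \<epsilon>)"
  shows "bounded_complexity M (orbit_avg_max T f)"
  unfolding bounded_complexity_def cover_number_le_iff
proof (intro allI impI)
  fix e :: real assume "0 < e"
  obtain \<A> where \<A>: "finite \<A>" "\<A> \<subseteq> sets M" "1 - e < measure M (\<Union>\<A>)"
    "\<forall>A\<in>\<A>. \<forall>x\<in>A. \<forall>y\<in>A. \<forall>n\<ge>1. orbit_avg T f n x y < e"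
    using ap[OF \<open>0 < e\<close>] unfolding almost_partition_def by (elim exE conjE)
  define F where "F = (\<lambda>A. SOME x. x \<in> A) ` (\<A> - {{}})"
  have F: "finite F" "card F \<le> Suc (card \<A>)"
    using \<A>(1) card_image_le[of "\<A> - {{}}" "\<lambda>A. SOME x. x \<in> A"] card_mono[of \<A> "\<A> - {{}}"]
    by (auto simp: F_def)
  have "1 - e < measure M (\<Union>x\<in>F. {y. orbit_avg_max T f n x y < e})" if n: "1 \<le> n" for n
  proof -
    have eq: "{y. orbit_avg_max T f n x y < e} = (\<Inter>k\<in>{1..n}. {y. orbit_avg T f k x y < e})" for x
      using n by (auto simp: orbit_avg_max_less_iff)
    have max_sets: "{y. orbit_avg_max T f n x y < e} \<in> sets M" for x
      unfolding eq by (rule sets.finite_INT) (use n ball_sets in auto)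
    have "\<Union>\<A> \<subseteq> (\<Union>x\<in>F. {y. orbit_avg_max T f n x y < e})"
    proof
      fix y assume "y \<in> \<Union>\<A>"
      then obtain A where A: "A \<in> \<A>" "y \<in> A" by blast
      have "(SOME x. x \<in> A) \<in> A" by (rule someI[of "\<lambda>x. x \<in> A", OF A(2)])
      then have "orbit_avg_max T f n (SOME x. x \<in> A) y < e"
        using \<A>(4) A n by (simp add: orbit_avg_max_less_iff)
      then show "y \<in> (\<Union>x\<in>F. {y. orbit_avg_max T f n x y < e})"
        using A by (auto simp: F_def)
    qed
    then have "measure M (\<Union>\<A>) \<le> measure M (\<Union>x\<in>F. {y. orbit_avg_max T f n x y < e})"
      by (rule finite_measure_mono) (use F(1) max_sets in \<open>auto intro!: sets.finite_UN\<close>)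
    then show ?thesis using \<A>(3) by simp
  qed
  then show "\<exists>C\<ge>1. \<forall>n\<ge>1. \<exists>F. finite F \<and> card F \<le> C \<and>
      1 - e < measure M (\<Union>x\<in>F. {y. orbit_avg_max T f n x y < e})"
    \<comment> \<open>The successor keeps the bound at least 1 when there are no pieces.\<close>
    using F by (intro exI[of _ "Suc (card \<A>)"]) auto
qed

end

section \<open>Equicontinuity on compact sets\<close>

lemma equicontinuous_in_the_mean_imp_mean_equicontinuous:
  assumes "equicontinuous_in_the_mean \<mu> T f"
  shows "mean_equicontinuous \<mu> T f"
  unfolding mean_equicontinuous_def
proof (intro allI impI)
  fix \<tau> :: real assume "0 < \<tau>"
  obtain K where K: "compact K" "1 - \<tau> < measure \<mu> K"
    "\<forall>\<epsilon>>0. \<exists>\<delta>>0. \<forall>x\<in>K. \<forall>y\<in>K. dist x y < \<delta> \<longrightarrow> (\<forall>n\<ge>1. orbit_avg T f n x y < \<epsilon>)"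
    using assms[unfolded equicontinuous_in_the_mean_def, rule_format, OF \<open>0 < \<tau>\<close>]
    by (elim exE conjE)
  have "\<exists>\<delta>>0. \<forall>x\<in>K. \<forall>y\<in>K. dist x y < \<delta> \<longrightarrow>
      limsup (\<lambda>n. ereal (orbit_avg T f n x y)) < ereal \<epsilon>" if "0 < \<epsilon>" for \<epsilon>
  proof -
    \<comment> \<open>A strict bound may become an equality in the limit superior, hence
      \<open>\<epsilon> / 2\<close>.\<close>
    obtain \<delta> where \<delta>: "0 < \<delta>"
      "\<forall>x\<in>K. \<forall>y\<in>K. dist x y < \<delta> \<longrightarrow> (\<forall>n\<ge>1. orbit_avg T f n x y < \<epsilon> / 2)"
      using K(3)[rule_format, OF half_gt_zero[OF \<open>0 < \<epsilon>\<close>]] by (elim exE conjE)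
    have "limsup (\<lambda>n. ereal (orbit_avg T f n x y)) < ereal \<epsilon>"
      if "x \<in> K" "y \<in> K" "dist x y < \<delta>" for x y
    proof -
      have "limsup (\<lambda>n. ereal (orbit_avg T f n x y)) \<le> ereal (\<epsilon> / 2)"
        by (rule Limsup_bounded)
          (use \<delta>(2)[rule_format, OF that] in \<open>auto simp: eventually_sequentially intro!: exI[of _ 1] less_imp_le\<close>)
      also have "\<dots> < ereal \<epsilon>" using \<open>0 < \<epsilon>\<close> by simp
      finally show ?thesis .
    qed
    then show ?thesis using \<delta>(1) by blast
  qed
  then show "\<exists>K. compact K \<and> measure \<mu> K > 1 - \<tau> \<and> (\<forall>\<epsilon>>0. \<exists>\<delta>>0. \<forall>x\<in>K. \<forall>y\<in>K. dist x y < \<delta> \<longrightarrow>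
      limsup (\<lambda>n. ereal (orbit_avg T f n x y)) < ereal \<epsilon>)"
    using K(1,2) by blast
qed

text \<open>A finite \<open>\<delta>\<close>-net of \<open>K\<close> provides the centres: the
  strict bound on the limit superior makes the averages to a nearby net point eventually less than
  \<open>\<epsilon> / 2\<close>.\<close>

lemma mean_equicontinuous_imp_almost_partition:
  fixes \<mu> :: "'a::metric_space measure"
  assumes "complex_observable \<mu> T f" and sets_\<mu>: "sets \<mu> = sets borel"
    and mean: "mean_equicontinuous \<mu> T f" and "0 < \<epsilon>"
  shows "almost_partition \<mu> \<epsilon> (\<lambda>x y. \<forall>n\<ge>1. orbit_avg T f n x y < \<epsilon>)"
proof -
  interpret complex_observable \<mu> T f by fact
  have "0 < \<epsilon> / 2" using \<open>0 < \<epsilon>\<close> by simp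
  then obtain K \<delta> where K: "compact K" "1 - \<epsilon> / 2 < measure \<mu> K" and \<delta>: "0 < \<delta>"
    "\<And>x y. x \<in> K \<Longrightarrow> y \<in> K \<Longrightarrow> dist x y < \<delta> \<Longrightarrow> limsup (\<lambda>n. ereal (orbit_avg T f n x y)) < ereal (\<epsilon> / 2)"
    using mean unfolding mean_equicontinuous_def by metis
  obtain F where F: "finite F" "F \<subseteq> K" "K \<subseteq> (\<Union>x\<in>F. ball x \<delta>)"
    using seq_compact_imp_totally_bounded[OF compact_imp_seq_compact[OF K(1)], rule_format, OF \<delta>(1)]
    by blast
  have "almost_partition \<mu> (2 * (\<epsilon> / 2)) (\<lambda>x y. \<forall>n\<ge>1. orbit_avg T f n x y < 2 * (\<epsilon> / 2))"
  proof (rule almost_partition_if_eventually_close)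
    show "finite F" by (rule F)
    show "K \<in> sets \<mu>" using compact_imp_closed[OF K(1)] by (simp add: sets_\<mu>)
    show "1 - \<epsilon> / 2 < measure \<mu> K" by (rule K)
    show "K \<subseteq> (\<Union>x\<in>F. {y. \<forall>\<^sub>F n in sequentially. orbit_avg T f n x y < \<epsilon> / 2})"
    proof
      fix y assume y: "y \<in> K"
      then obtain x where x: "x \<in> F" "dist x y < \<delta>" using F(3) by auto
      then have "limsup (\<lambda>n. ereal (orbit_avg T f n x y)) < ereal (\<epsilon> / 2)"
        using \<delta>(2) F(2) y by blast
      then have "\<forall>\<^sub>F n in sequentially. ereal (orbit_avg T f n x y) < ereal (\<epsilon> / 2)"
        by (rule Limsup_lessD)
      then show "y \<in> (\<Union>x\<in>F. {y. \<forall>\<^sub>F n in sequentially. orbit_avg T f n x y < \<epsilon> / 2})"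
        using x(1) by auto
    qed
  qed (use \<open>0 < \<epsilon>\<close> in auto)
  then show ?thesis by simp
qed

lemma almost_partition_imp_equicontinuous_in_the_mean:
  fixes \<mu> :: "'a::metric_space measure"
  assumes "prob_space \<mu>" "compact (UNIV :: 'a set)" "sets \<mu> = sets borel"
    and ap: "\<And>\<epsilon>. 0 < \<epsilon> \<Longrightarrow> almost_partition \<mu> \<epsilon> (\<lambda>x y. \<forall>n\<ge>1. orbit_avg T f n x y < \<epsilon>)"
  shows "equicontinuous_in_the_mean \<mu> T f"
  unfolding equicontinuous_in_the_mean_def
proof (intro allI impI)
  fix \<tau> :: real assume "0 < \<tau>"
  have "\<exists>K. compact K \<and> 1 - \<tau> < measure \<mu> K \<and> (\<forall>\<epsilon>>0. \<exists>e. 0 < e \<and> e < \<epsilon> \<and>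
      (\<exists>\<delta>>0. \<forall>x\<in>K. \<forall>y\<in>K. dist x y < \<delta> \<longrightarrow> (\<forall>n\<ge>1. orbit_avg T f n x y < e)))"
    by (rule almost_partition_imp_compact[OF assms(1-3) _ \<open>0 < \<tau>\<close>]) (rule ap)
  then obtain K where K: "compact K" "1 - \<tau> < measure \<mu> K"
    "\<forall>\<epsilon>>0. \<exists>e. 0 < e \<and> e < \<epsilon> \<and>
      (\<exists>\<delta>>0. \<forall>x\<in>K. \<forall>y\<in>K. dist x y < \<delta> \<longrightarrow> (\<forall>n\<ge>1. orbit_avg T f n x y < e))"
    by (elim exE conjE)
  have "\<exists>\<delta>>0. \<forall>x\<in>K. \<forall>y\<in>K. dist x y < \<delta> \<longrightarrow> (\<forall>n\<ge>1. orbit_avg T f n x y < \<epsilon>)" if "0 < \<epsilon>" for \<epsilon>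
    using K(3)[rule_format, OF that] by (meson less_trans)
  then show "\<exists>K. compact K \<and> measure \<mu> K > 1 - \<tau> \<and> (\<forall>\<epsilon>>0. \<exists>\<delta>>0. \<forall>x\<in>K. \<forall>y\<in>K. dist x y < \<delta> \<longrightarrow>
      (\<forall>n\<ge>1. orbit_avg T f n x y < \<epsilon>))"
    using K(1,2) by blast
qed

theorem theorem4p7:
  fixes \<mu> :: "'a::metric_space measure"
    and T :: "'a \<Rightarrow> 'a"
    and f :: "'a \<Rightarrow> complex"
  assumes "compact (UNIV :: 'a set)"
    and "\<exists>S. homeomorphism UNIV UNIV T S"
    and "prob_space \<mu>"
    and "sets \<mu> = sets borel"
    and "distr \<mu> borel T = \<mu>"
    and "integrable \<mu> f"
  shows "(mean_equicontinuous \<mu> T f \<longleftrightarrow> equicontinuous_in_the_mean \<mu> T f) \<and>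
    (equicontinuous_in_the_mean \<mu> T f \<longleftrightarrow> bounded_complexity \<mu> (orbit_avg T f)) \<and>
    (bounded_complexity \<mu> (orbit_avg T f) \<longleftrightarrow> bounded_complexity \<mu> (orbit_avg_max T f)) \<and>
    (bounded_complexity \<mu> (orbit_avg_max T f) \<longleftrightarrow>
      (\<forall>\<epsilon>>0. \<exists>k\<ge>1. \<exists>A :: nat \<Rightarrow> 'a set.
        (\<forall>i\<in>{1..k}. A i \<in> sets \<mu>) \<and>
        measure \<mu> (\<Union>i\<in>{1..k}. A i) > 1 - \<epsilon> \<and>
        (\<forall>i\<in>{1..k}. \<forall>x\<in>A i. \<forall>y\<in>A i. \<forall>n\<ge>1. orbit_avg_max T f n x y < \<epsilon>)))"
proof -
  interpret prob_space \<mu> by fact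
  obtain S where "homeomorphism UNIV UNIV T S" using assms(2) by blast
  then have "continuous_on UNIV T" by (simp add: homeomorphism_def)
  then have "T \<in> measurable borel borel" by (rule borel_measurable_continuous_onI)
  then have "T \<in> measurable \<mu> \<mu>" using measurable_cong_sets[OF assms(4) assms(4)] by simp
  moreover have "distr \<mu> \<mu> T = \<mu>" using assms(5) distr_cong[OF refl assms(4), of \<mu> T T] by simp
  moreover have "space \<mu> = UNIV" using sets_eq_imp_space_eq[OF assms(4)] by simp
  ultimately have obs: "complex_observable \<mu> T f"
    by unfold_locales (use assms(6) in auto)
  then interpret complex_observable \<mu> T f .
  \<comment> \<open>\<open>?P\<close> is the hub: (1) gives \<open>?P\<close>, which gives (2),
    which gives (1); and \<open>?P\<close> gives (4), which gives (3), which gives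
    \<open>?P\<close>. Condition (5) is rewritten into \<open>?P\<close> at the end.\<close>
  let ?P = "\<forall>\<epsilon>>0. almost_partition \<mu> \<epsilon> (\<lambda>x y. \<forall>n\<ge>1. orbit_avg T f n x y < \<epsilon>)"
  have "mean_equicontinuous \<mu> T f \<Longrightarrow> ?P"
    using mean_equicontinuous_imp_almost_partition[OF obs assms(4)] by blast
  moreover have "?P \<Longrightarrow> equicontinuous_in_the_mean \<mu> T f"
    using almost_partition_imp_equicontinuous_in_the_mean[OF assms(3,1,4)] by blast
  moreover have "equicontinuous_in_the_mean \<mu> T f \<Longrightarrow> mean_equicontinuous \<mu> T f"
    by (rule equicontinuous_in_the_mean_imp_mean_equicontinuous)
  moreover have "?P \<Longrightarrow> bounded_complexity \<mu> (orbit_avg_max T f)"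
    using bounded_complexity_max_if_almost_partition by blast
  moreover have "bounded_complexity \<mu> (orbit_avg_max T f) \<Longrightarrow> bounded_complexity \<mu> (orbit_avg T f)"
    by (rule bounded_complexity_orbit_avg_if_max)
  moreover have "bounded_complexity \<mu> (orbit_avg T f) \<Longrightarrow> ?P"
    using bounded_complexity_orbit_avg_imp_almost_partition by blast
  ultimately show ?thesis
    unfolding almost_partition_iff_indexed[symmetric] by blast
qed

end
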